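(* (1) The quantum and classical Berezin equations of motion on the Siegel-Jacobi disk $\mathcal{D}^J_1$ determined by a hermitian Hamiltonian linear in the generators of the Jacobi group $G^J_1$, expressed in the $FC$-coordinates $(\eta,w)$, are the same as the equations obtained applying the Wei-Norman method. (2) Consider the equations of motion obtained with the Wei-Norman method and determined by the hermitian Hamiltonian $$\mathbf{H}_0=\epsilon_a\mathbf{a}+\bar\epsilon_a\mathbf{a}^\dagger+\epsilon_0\mathbf{K}_0+\epsilon_+\mathbf{K}_++\epsilon_-\mathbf{K}_-,\qquad \bar\epsilon_+=\epsilon_-,\ \epsilon_0=\bar\epsilon_0,$$ or equivalently, in real form, $\mathbf{H}_0=2\varepsilon_0\mathbf{K}_0+2\varepsilon_1\mathbf{K}_1+2\varepsilon_2\mathbf{K}_2+\nu_1\mathbf{N}_1+\nu_2\mathbf{N}_2$, linear in the generators of the Jacobi group $G^J_1$, namely: on $\mathcal{D}_1$, $$i\dot w=\epsilon_++\epsilon_0w+\epsilon_-w^2;$$ on $\mathbb{C}$, $$i\dot\eta=\bar\epsilon_a+\epsilon_+\bar\eta+\tfrac{\epsilon_0}{2}\eta;$$ and on $\mathbb{R}^2$, with $\eta=x+iy$, $$\dot x=-\varepsilon_2x+(\varepsilon_0-\varepsilon_1)y-\nu_2,\qquad \dot y=-(\varepsilon_0+\varepsilon_1)x+\varepsilon_2y-\nu_1.$$ These are a particular case of the following Berezin equations of motion, determined by the hermitian Hamiltonian $$\mathbf{H}=\epsilon_i\mathbf{a}_i+\bar\epsilon_i\mathbf{a}_i^\dagger+\epsilon^0_{ij}\mathbf{K}^0_{ij}+\epsilon^-_{ij}\mathbf{K}^-_{ij}+\epsilon^+_{ij}\mathbf{K}^+_{ij}$$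 linear in the generators of the Jacobi group $G^J_n$: respectively, on $\mathcal{D}_n$, $$i\dot W=\epsilon_-+(W\epsilon_0)^s+W\epsilon_+W,\qquad W\in\mathcal{D}_n;$$ on $\mathbb{C}^n$, $$i\dot\eta=\epsilon+\epsilon_-\bar\eta+\tfrac12\epsilon_0^t\eta,\qquad \eta\in\mathbb{C}^n;$$ and on $\mathbb{R}^{2n}$, with $\eta=\xi-i\zeta$, $\xi,\zeta\in\mathbb{R}^n$, $$\dot Z=h_rZ+F,\quad Z=\begin{pmatrix}\xi\\ \zeta\end{pmatrix},\quad F=\begin{pmatrix}a\\ b\end{pmatrix},\quad h_r=\begin{pmatrix}n+q&m-p\\ m+p&-n+q\end{pmatrix}\in\mathfrak{sp}(n,\mathbb{R}).$$
   Context: Jacobi algebra. $\mathfrak{g}^J_1=\mathfrak{h}_1\rtimes\mathfrak{su}(1,1)$ is the Lie algebra of the Jacobi group $G^J_1=H_1\rtimes\mathrm{SU}(1,1)$ ($H_1$ the 3-dimensional Heisenberg group). Its generators $I,a,a^\dagger,K_0,K_+,K_-$ satisfy, with $I$ central, $[a,a^\dagger]=I$; $[K_0,K_\pm]=\pm K_\pm$, $[K_-,K_+]=2K_0$; $[a,K_+]=a^\dagger$, $[K_-,a^\dagger]=a$, $[K_+,a^\dagger]=[K_-,a]=0$; $[K_0,a^\dagger]=\tfrac12a^\dagger$, $[K_0,a]=-\tfrac12a$. Boldface letters denote the corresponding operators in a unitary irreducible representation in which $I$ acts as the identity. The real generators are $\mathbf{N}_1=\mathbf{a}+\mathbf{a}^\dagger$,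 $\mathbf{N}_2=i(\mathbf{a}-\mathbf{a}^\dagger)$, $\mathbf{K}_1=\tfrac12(\mathbf{K}_++\mathbf{K}_-)$, $\mathbf{K}_2=\tfrac1{2i}(\mathbf{K}_+-\mathbf{K}_-)$, and the real and complex coefficients of $\mathbf{H}_0$ are related by $\epsilon_a=\nu_1+i\nu_2$, $\epsilon_0=2\varepsilon_0$, $\epsilon_+=\varepsilon_1-i\varepsilon_2$, with $\nu_1,\nu_2,\varepsilon_0,\varepsilon_1,\varepsilon_2$ real. $\mathcal{D}_1=\{w\in\mathbb{C}:|w|<1\}$ is the Siegel disk, $\mathcal{D}^J_1=\mathbb{C}\times\mathcal{D}_1$ the Siegel-Jacobi disk. A dot in the Wei-Norman equations is the derivative with respect to $\tau=t/\hbar$. Wei-Norman equations. For $\xi=(\eta,w)\in\mathbb{C}\times\mathcal{D}_1$ let $T(\xi)=D(\eta)S(w)$, where $D(\eta)=\exp(\eta\mathbf{a}^\dagger-\bar\eta\mathbf{a})$ and $S(w)=\exp(w\mathbf{K}_+)\exp(\ln(1-w\bar w)\mathbf{K}_0)\exp(-\bar w\mathbf{K}_-)$. For a curve $\xi(\tau)$ and a real phase $\varphi(\tau)$ consider $$\hat{\mathbf{E}}=\dot\varphi\,\mathbf{I}+i\,T(\xi)^{-1}\dot T(\xi)-T(\xi)^{-1}\mathbf{H}_0T(\xi),$$ where $T^{-1}\dot T$ is computed from the product-of-exponentials form of $T$ (Wei-Norman method); it is a linear combination of $\mathbf{I},\mathbf{a},\mathbf{a}^\dagger,\mathbf{K}_0,\mathbf{K}_+,\mathbf{K}_-$.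 The equations of motion obtained with the Wei-Norman method are those stating that the coefficients of $\mathbf{a},\mathbf{a}^\dagger,\mathbf{K}_+,\mathbf{K}_-$ (equivalently of $\mathbf{N}_1,\mathbf{N}_2,\mathbf{K}_1,\mathbf{K}_2$) in $\hat{\mathbf{E}}$ vanish. They are the equations for $w$, $\eta$ and $(x,y)$ displayed first in part (2). Berezin equations. For a Hamiltonian $\mathbf{H}=\sum_\lambda\epsilon_\lambda\mathbf{X}_\lambda$ linear in generators $X_\lambda$ represented by holomorphic first-order differential operators $\mathbb{X}_\lambda=P_\lambda+\sum_\beta Q_{\lambda,\beta}\,\partial/\partial z_\beta$ with polynomial coefficients, Berezin's equations, which describe both the classical motion and the quantum evolution, are $i\dot z_\beta=\sum_\lambda\epsilon_\lambda Q_{\lambda,\beta}$. On $\mathcal{D}^J_1$, with coordinates $(z,w)\in\mathbb{C}\times\mathcal{D}_1$ and a parameter $k>0$, $2k=2,3,\dots$, the differential action is $\mathbf{a}\mapsto\frac{\partial}{\partial z}$, $\mathbf{a}^\dagger\mapsto z+w\frac{\partial}{\partial z}$, $\mathbf{K}_-\mapsto\frac{\partial}{\partial w}$, $\mathbf{K}_0\mapsto k+\frac12z\frac{\partial}{\partial z}+w\frac{\partial}{\partial w}$, $\mathbf{K}_+\mapsto\frac12z^2+2kw+zw\frac{\partial}{\partial z}+w^2\frac{\partial}{\partial w}$. The $FC$-transform is the change of variables $(\eta,w)\mapsto(z,w)$, $z=\eta-w\bar\eta$; $(\eta,w)$ are the $FC$-coordinates. In them the Berezin equations for $\mathbf{H}_0$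 read $i\dot\eta=\epsilon_a+\epsilon_-\bar\eta+\frac{\epsilon_0}{2}\eta$, $i\dot w=\epsilon_-+\epsilon_0w+\epsilon_+w^2$. Convention for the comparison. The Wei-Norman and Berezin equations are identified up to the difference of notation $\epsilon_a\leftrightarrow\bar\epsilon_a$, $\epsilon_+\leftrightarrow\epsilon_-=\bar\epsilon_+$. General $n$. $G^J_n$ is the semidirect product of the $(2n+1)$-dimensional Heisenberg group with $\mathrm{Sp}(n,\mathbb{R})_{\mathbb{C}}$; $\mathcal{D}_n=\{W\in M(n,\mathbb{C}):W=W^t,\ \mathbb{I}_n-W\bar W>0\}$ is the Siegel ball, and $\mathcal{D}^J_n=\mathbb{C}^n\times\mathcal{D}_n$ (as a set) is the Siegel-Jacobi ball. In $\mathbf{H}$ repeated indices are summed, $\mathbf{a}_i,\mathbf{a}_i^\dagger,\mathbf{K}^{0}_{ij},\mathbf{K}^{\pm}_{ij}$ represent the generators of $G^J_n$, $\epsilon=(\epsilon_i)\in\mathbb{C}^n$, and the matrices $\epsilon_0=(\epsilon^0_{ij})$, $\epsilon_\pm=(\epsilon^\pm_{ij})$ satisfy the hermiticity conditions $\epsilon_0^\dagger=\epsilon_0$, $\epsilon_\pm=\epsilon_\pm^t$, $\epsilon_+^\dagger=\epsilon_-$. The Berezin equations for $\mathbf{H}$ are written in the $FC$-coordinates $(\eta,W)\in\mathbb{C}^n\times\mathcal{D}_n$, $z=\eta-W\bar\eta$. Here $A^s=\tfrac12(A+A^t)$, and in the real form $\epsilon=b+ia$ with $a,b\in\mathbb{R}^n$,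 $\epsilon_-=m+in$, $\tfrac12\epsilon_0^t=p+iq$ with $m,n,p,q$ real $n\times n$ matrices, $m,n,p$ symmetric and $q$ antisymmetric (the matrix $n$ and the dimension $n$ are denoted by the same letter). *)

theory Defs
  imports "HOL-Analysis.Analysis"
begin

abbreviation dot :: "(real \<Rightarrow> 'a::real_normed_vector) \<Rightarrow> real \<Rightarrow> 'a"
  where "dot f \<tau> \<equiv> vector_derivative f (at \<tau>)"

text \<open>A linear combination of generators is the vector of its coefficients, indexed by a
  finite type of generators; \<open>gen g\<close> is the generator \<open>g\<close> itself.\<close>

definition gen :: "'g \<Rightarrow> complex ^ 'g::finite"
  where "gen g = axis g 1"


section \<open>The Jacobi algebra and the Wei-Norman equations\<close>

datatype jgen = GI | Ga | Gad | GK0 | GKp | GKm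

instance jgen :: finite
proof
  have "(UNIV :: jgen set) \<subseteq> {GI, Ga, Gad, GK0, GKp, GKm}"
    using jgen.exhaust by blast
  then show "finite (UNIV :: jgen set)"
    by (rule finite_subset) simp
qed

type_synonym jalg = "complex ^ jgen"

text \<open>Each nonzero commutator of generators is listed in one order only;
  \<open>jbracket\<close> extends the table antisymmetrically and complex bilinearly.\<close>

fun jcomm :: "jgen \<Rightarrow> jgen \<Rightarrow> jalg" where
  "jcomm Ga Gad = gen GI"
| "jcomm GK0 GKp = gen GKp"
| "jcomm GK0 GKm = - gen GKm"
| "jcomm GKm GKp = 2 *s gen GK0"
| "jcomm Ga GKp = gen Gad"
| "jcomm GKm Gad = gen Ga"
| "jcomm GK0 Gad = (1/2) *s gen Gad"
| "jcomm GK0 Ga = - ((1/2) *s gen Ga)"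
| "jcomm _ _ = 0"

definition jbracket :: "jalg \<Rightarrow> jalg \<Rightarrow> jalg"
  where "jbracket X Y = (\<Sum>g\<in>UNIV. \<Sum>h\<in>UNIV. (X $ g * Y $ h - X $ h * Y $ g) *s jcomm g h)"

text \<open>\<open>exp A \<cdot> X \<cdot> exp (-A)\<close>, as the exponential series of the operator \<open>[A, _]\<close>.\<close>

definition exp_ad :: "jalg \<Rightarrow> jalg \<Rightarrow> jalg"
  where "exp_ad A X = (\<Sum>n. (1 / fact n) *\<^sub>R (jbracket A ^^ n) X)"

text \<open>\<open>exp (-A) \<cdot> d/d\<tau> (exp A)\<close> for a curve with value \<open>A\<close> and velocity \<open>A'\<close>: this is
  \<open>(1 - e\<^sup>-\<^sup>x) / x\<close> at \<open>x = [A, _]\<close>, applied to \<open>A'\<close>. If \<open>A'\<close> is a multiple of \<open>A\<close>,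
  it is just \<open>A'\<close>; for \<open>A\<close> in the Heisenberg algebra it is \<open>A' - [A, A'] / 2\<close>.\<close>

definition exp_logderiv :: "jalg \<Rightarrow> jalg \<Rightarrow> jalg"
  where "exp_logderiv A A' = (\<Sum>n. ((- 1) ^ n / fact (Suc n)) *\<^sub>R (jbracket A ^^ n) A')"

text \<open>A list \<open>[A\<^sub>1, \<dots>, A\<^sub>r]\<close> stands for the product \<open>T = exp A\<^sub>1 \<cdots> exp A\<^sub>r\<close>.
  The following are \<open>T\<inverse> X T\<close> and \<open>T\<inverse> dT/d\<tau>\<close>; for \<open>T = exp A \<cdot> U\<close> the latter is
  \<open>U\<inverse> (exp (-A) (exp A)') U + U\<inverse> U'\<close>.\<close>

fun conj_by :: "jalg list \<Rightarrow> jalg \<Rightarrow> jalg" where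
  "conj_by [] X = X"
| "conj_by (A # As) X = conj_by As (exp_ad (- A) X)"

fun logderiv :: "(real \<Rightarrow> jalg) list \<Rightarrow> real \<Rightarrow> jalg" where
  "logderiv [] \<tau> = 0"
| "logderiv (A # As) \<tau> =
     conj_by (map (\<lambda>B. B \<tau>) As) (exp_logderiv (A \<tau>) (dot A \<tau>)) + logderiv As \<tau>"

text \<open>\<open>T = D(\<eta>) S(w)\<close>.\<close>

definition T_factors :: "(real \<Rightarrow> complex) \<Rightarrow> (real \<Rightarrow> complex) \<Rightarrow> (real \<Rightarrow> jalg) list"
  where "T_factors \<eta> w =
    [\<lambda>\<tau>. \<eta> \<tau> *s gen Gad - cnj (\<eta> \<tau>) *s gen Ga,
     \<lambda>\<tau>. w \<tau> *s gen GKp,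
     \<lambda>\<tau>. complex_of_real (ln (1 - (cmod (w \<tau>))\<^sup>2)) *s gen GK0,
     \<lambda>\<tau>. (- cnj (w \<tau>)) *s gen GKm]"

definition E_hat :: "jalg \<Rightarrow> (real \<Rightarrow> real) \<Rightarrow> (real \<Rightarrow> complex) \<Rightarrow> (real \<Rightarrow> complex) \<Rightarrow> real \<Rightarrow> jalg"
  where "E_hat H \<phi> \<eta> w \<tau> =
    complex_of_real (dot \<phi> \<tau>) *s gen GI
    + \<i> *s logderiv (T_factors \<eta> w) \<tau>
    - conj_by (map (\<lambda>A. A \<tau>) (T_factors \<eta> w)) H"

definition wei_norman_eqs ::
  "jalg \<Rightarrow> (real \<Rightarrow> real) \<Rightarrow> (real \<Rightarrow> complex) \<Rightarrow> (real \<Rightarrow> complex) \<Rightarrow> real \<Rightarrow> bool"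
  where "wei_norman_eqs H \<phi> \<eta> w \<tau> \<longleftrightarrow> (\<forall>g\<in>{Ga, Gad, GKp, GKm}. E_hat H \<phi> \<eta> w \<tau> $ g = 0)"

definition H0 :: "complex \<Rightarrow> complex \<Rightarrow> complex \<Rightarrow> complex \<Rightarrow> jalg"
  where "H0 \<epsilon>a \<epsilon>0 \<epsilon>p \<epsilon>m =
    \<epsilon>a *s gen Ga + cnj \<epsilon>a *s gen Gad + \<epsilon>0 *s gen GK0 + \<epsilon>p *s gen GKp + \<epsilon>m *s gen GKm"

definition hermitian_coeffs :: "complex \<Rightarrow> complex \<Rightarrow> complex \<Rightarrow> bool"
  where "hermitian_coeffs \<epsilon>0 \<epsilon>p \<epsilon>m \<longleftrightarrow> cnj \<epsilon>0 = \<epsilon>0 \<and> cnj \<epsilon>p = \<epsilon>m"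

definition N1 :: jalg where "N1 = gen Ga + gen Gad"
definition N2 :: jalg where "N2 = \<i> *s (gen Ga - gen Gad)"
definition K1 :: jalg where "K1 = (1/2) *s (gen GKp + gen GKm)"
definition K2 :: jalg where "K2 = (1 / (2 * \<i>)) *s (gen GKp - gen GKm)"

definition H0_real :: "real \<Rightarrow> real \<Rightarrow> real \<Rightarrow> real \<Rightarrow> real \<Rightarrow> jalg"
  where "H0_real e0 e1 e2 \<nu>1 \<nu>2 =
    complex_of_real (2 * e0) *s gen GK0 + complex_of_real (2 * e1) *s K1
    + complex_of_real (2 * e2) *s K2 + complex_of_real \<nu>1 *s N1 + complex_of_real \<nu>2 *s N2"

definition siegel_disk :: "complex set"
  where "siegel_disk = {w. cmod w < 1}"

definition wn_w_eq :: "complex \<Rightarrow> complex \<Rightarrow> complex \<Rightarrow> (real \<Rightarrow> complex) \<Rightarrow> real \<Rightarrow> bool"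
  where "wn_w_eq \<epsilon>0 \<epsilon>p \<epsilon>m w \<tau> \<longleftrightarrow> \<i> * dot w \<tau> = \<epsilon>p + \<epsilon>0 * w \<tau> + \<epsilon>m * (w \<tau>)\<^sup>2"

definition wn_eta_eq :: "complex \<Rightarrow> complex \<Rightarrow> complex \<Rightarrow> (real \<Rightarrow> complex) \<Rightarrow> real \<Rightarrow> bool"
  where "wn_eta_eq \<epsilon>a \<epsilon>0 \<epsilon>p \<eta> \<tau> \<longleftrightarrow>
    \<i> * dot \<eta> \<tau> = cnj \<epsilon>a + \<epsilon>p * cnj (\<eta> \<tau>) + \<epsilon>0 / 2 * \<eta> \<tau>"

definition wn_xy_eq ::
  "real \<Rightarrow> real \<Rightarrow> real \<Rightarrow> real \<Rightarrow> real \<Rightarrow> (real \<Rightarrow> real) \<Rightarrow> (real \<Rightarrow> real) \<Rightarrow> real \<Rightarrow> bool"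
  where "wn_xy_eq e0 e1 e2 \<nu>1 \<nu>2 x y \<tau> \<longleftrightarrow>
    dot x \<tau> = - e2 * x \<tau> + (e0 - e1) * y \<tau> - \<nu>2 \<and>
    dot y \<tau> = - (e0 + e1) * x \<tau> + e2 * y \<tau> - \<nu>1"


section \<open>Berezin's equations\<close>

text \<open>The operator \<open>P + \<Sum>\<^sub>\<beta> Q\<^sub>\<beta> \<partial>/\<partial>z\<^sub>\<beta>\<close>, by its coefficient functions of the point \<open>z\<close>
  (the family of coordinates \<open>z\<^sub>\<beta>\<close>); \<open>Q\<^sub>\<beta>\<close> is the value of the derivation on the
  coordinate function \<open>z\<^sub>\<beta>\<close>.\<close>

record 'b diff_op =
  dP :: "('b \<Rightarrow> complex) \<Rightarrow> complex"
  dQ :: "'b \<Rightarrow> ('b \<Rightarrow> complex) \<Rightarrow> complex"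

definition berezin_eqs ::
  "('g \<Rightarrow> 'b diff_op) \<Rightarrow> complex ^ 'g::finite \<Rightarrow> (real \<Rightarrow> 'b \<Rightarrow> complex) \<Rightarrow> real \<Rightarrow> bool"
  where "berezin_eqs X \<epsilon> z \<tau> \<longleftrightarrow>
    (\<forall>\<beta>. \<i> * dot (\<lambda>t. z t \<beta>) \<tau> = (\<Sum>g\<in>UNIV. \<epsilon> $ g * dQ (X g) \<beta> (z \<tau>)))"

datatype disk_coord = Cz | Cw

definition disk_op ::
  "(complex \<Rightarrow> complex \<Rightarrow> complex) \<Rightarrow> (complex \<Rightarrow> complex \<Rightarrow> complex) \<Rightarrow> (complex \<Rightarrow> complex \<Rightarrow> complex)
   \<Rightarrow> disk_coord diff_op"
  where "disk_op p qz qw =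
    \<lparr>dP = (\<lambda>c. p (c Cz) (c Cw)),
     dQ = (\<lambda>\<beta> c. case \<beta> of Cz \<Rightarrow> qz (c Cz) (c Cw) | Cw \<Rightarrow> qw (c Cz) (c Cw))\<rparr>"

fun disk_action :: "real \<Rightarrow> jgen \<Rightarrow> disk_coord diff_op" where
  "disk_action k GI  = disk_op (\<lambda>z w. 1) (\<lambda>z w. 0) (\<lambda>z w. 0)"
| "disk_action k Ga  = disk_op (\<lambda>z w. 0) (\<lambda>z w. 1) (\<lambda>z w. 0)"
| "disk_action k Gad = disk_op (\<lambda>z w. z) (\<lambda>z w. w) (\<lambda>z w. 0)"
| "disk_action k GKm = disk_op (\<lambda>z w. 0) (\<lambda>z w. 0) (\<lambda>z w. 1)"
| "disk_action k GK0 = disk_op (\<lambda>z w. of_real k) (\<lambda>z w. z / 2) (\<lambda>z w. w)"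
| "disk_action k GKp = disk_op (\<lambda>z w. z\<^sup>2 / 2 + 2 * of_real k * w) (\<lambda>z w. z * w) (\<lambda>z w. w\<^sup>2)"

text \<open>A curve given in \<open>FC\<close>-coordinates, rewritten in the coordinates \<open>(z, w)\<close>.\<close>

definition disk_FC :: "(real \<Rightarrow> complex) \<Rightarrow> (real \<Rightarrow> complex) \<Rightarrow> real \<Rightarrow> disk_coord \<Rightarrow> complex"
  where "disk_FC \<eta> w t \<beta> = (case \<beta> of Cz \<Rightarrow> \<eta> t - w t * cnj (\<eta> t) | Cw \<Rightarrow> w t)"


section \<open>The Siegel-Jacobi ball\<close>

datatype 'n ngen = NI | Na 'n | Nad 'n | NK0 'n 'n | NKp 'n 'n | NKm 'n 'n

instance ngen :: (finite) finite
proof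
  let ?S = "{NI} \<union> range Na \<union> range Nad \<union> range (\<lambda>(i, j). NK0 i j)
    \<union> range (\<lambda>(i, j). NKp i j) \<union> range (\<lambda>(i, j). NKm i j) :: 'a ngen set"
  have "x \<in> ?S" for x :: "'a ngen"
    by (cases x) (auto simp: image_iff)
  then have "(UNIV :: 'a ngen set) \<subseteq> ?S" by blast
  then show "finite (UNIV :: 'a ngen set)"
    by (rule finite_subset) simp
qed

definition vcnj :: "complex ^ 'n \<Rightarrow> complex ^ 'n"
  where "vcnj v = (\<chi> i. cnj (v $ i))"

definition mcnj :: "complex ^ 'n ^ 'm \<Rightarrow> complex ^ 'n ^ 'm"
  where "mcnj A = (\<chi> i j. cnj (A $ i $ j))"

definition msmult :: "complex \<Rightarrow> complex ^ 'n ^ 'm \<Rightarrow> complex ^ 'n ^ 'm"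
  where "msmult c A = (\<chi> i j. c * A $ i $ j)"

definition msym :: "complex ^ 'n ^ 'n \<Rightarrow> complex ^ 'n ^ 'n"
  where "msym A = msmult (1/2) (A + transpose A)"

definition cvec :: "real ^ 'n \<Rightarrow> real ^ 'n \<Rightarrow> complex ^ 'n"
  where "cvec u v = (\<chi> i. Complex (u $ i) (v $ i))"

definition cmat :: "real ^ 'n ^ 'm \<Rightarrow> real ^ 'n ^ 'm \<Rightarrow> complex ^ 'n ^ 'm"
  where "cmat A B = (\<chi> i j. Complex (A $ i $ j) (B $ i $ j))"

definition positive_definite :: "complex ^ 'n ^ 'n \<Rightarrow> bool"
  where "positive_definite A \<longleftrightarrow>
    transpose (mcnj A) = A \<and>
    (\<forall>v. v \<noteq> 0 \<longrightarrow> 0 < Re (\<Sum>i\<in>UNIV. cnj (v $ i) * (A *v v) $ i))"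

definition siegel_ball :: "(complex ^ 'n ^ 'n) set"
  where "siegel_ball = {W. W = transpose W \<and> positive_definite (mat 1 - W ** mcnj W)}"

definition Hn :: "complex ^ 'n \<Rightarrow> complex ^ 'n ^ 'n \<Rightarrow> complex ^ 'n ^ 'n \<Rightarrow> complex ^ 'n ^ 'n
    \<Rightarrow> complex ^ ('n::finite) ngen"
  where "Hn \<epsilon> \<epsilon>0 \<epsilon>p \<epsilon>m =
    (\<Sum>i\<in>UNIV. (\<epsilon> $ i) *s gen (Na i) + cnj (\<epsilon> $ i) *s gen (Nad i))
    + (\<Sum>i\<in>UNIV. \<Sum>j\<in>UNIV. (\<epsilon>0 $ i $ j) *s gen (NK0 i j) + (\<epsilon>m $ i $ j) *s gen (NKm i j)
          + (\<epsilon>p $ i $ j) *s gen (NKp i j))"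

definition hermitian_coeffs_n ::
  "complex ^ 'n ^ 'n \<Rightarrow> complex ^ 'n ^ 'n \<Rightarrow> complex ^ 'n ^ 'n \<Rightarrow> bool"
  where "hermitian_coeffs_n \<epsilon>0 \<epsilon>p \<epsilon>m \<longleftrightarrow>
    transpose (mcnj \<epsilon>0) = \<epsilon>0 \<and> transpose \<epsilon>p = \<epsilon>p \<and> transpose \<epsilon>m = \<epsilon>m \<and>
    transpose (mcnj \<epsilon>p) = \<epsilon>m"

text \<open>The matrix coordinate \<open>W\<close> is symmetric: \<open>\<partial>\<^sub>i\<^sub>j\<close> below is the derivation with
  \<open>\<partial>\<^sub>i\<^sub>j w\<^sub>l\<^sub>m = (\<delta>\<^sub>i\<^sub>l \<delta>\<^sub>j\<^sub>m + \<delta>\<^sub>i\<^sub>m \<delta>\<^sub>j\<^sub>l) / 2\<close>, that is \<open>(1 + \<delta>\<^sub>i\<^sub>j) / 2 \<cdot> \<partial>/\<partial>w\<^sub>i\<^sub>j\<close> in the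
  independent coordinates \<open>w\<^sub>i\<^sub>j = w\<^sub>j\<^sub>i\<close>. With \<open>\<partial>\<^sub>i = \<partial>/\<partial>z\<^sub>i\<close> the action is
    \<open>a\<^sub>i \<mapsto> \<partial>\<^sub>i\<close>,
    \<open>a\<^sup>\<dagger>\<^sub>i \<mapsto> z\<^sub>i + \<Sum>\<^sub>l w\<^sub>i\<^sub>l \<partial>\<^sub>l\<close>,
    \<open>K\<^sup>-\<^sub>i\<^sub>j \<mapsto> \<partial>\<^sub>i\<^sub>j\<close>,
    \<open>K\<^sup>0\<^sub>i\<^sub>j \<mapsto> k \<delta>\<^sub>i\<^sub>j + z\<^sub>i \<partial>\<^sub>j / 2 + \<Sum>\<^sub>l w\<^sub>i\<^sub>l \<partial>\<^sub>l\<^sub>j\<close>,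
    \<open>K\<^sup>+\<^sub>i\<^sub>j \<mapsto> z\<^sub>i z\<^sub>j / 2 + 2 k w\<^sub>i\<^sub>j + \<Sum>\<^sub>l (z\<^sub>i w\<^sub>j\<^sub>l + z\<^sub>j w\<^sub>i\<^sub>l) \<partial>\<^sub>l / 2 + \<Sum>\<^sub>l\<^sub>m w\<^sub>i\<^sub>l w\<^sub>j\<^sub>m \<partial>\<^sub>l\<^sub>m\<close>.
  For \<open>n = 1\<close> it is the action on the Siegel-Jacobi disk.\<close>

datatype 'n ball_coord = Bz 'n | Bw 'n 'n

definition ball_op ::
  "(('n ball_coord \<Rightarrow> complex) \<Rightarrow> complex)
   \<Rightarrow> ('n \<Rightarrow> ('n ball_coord \<Rightarrow> complex) \<Rightarrow> complex)
   \<Rightarrow> ('n \<Rightarrow> 'n \<Rightarrow> ('n ball_coord \<Rightarrow> complex) \<Rightarrow> complex) \<Rightarrow> 'n ball_coord diff_op"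
  where "ball_op p qz qw =
    \<lparr>dP = p, dQ = (\<lambda>\<beta> c. case \<beta> of Bz l \<Rightarrow> qz l c | Bw l m \<Rightarrow> qw l m c)\<rparr>"

fun ball_action :: "real \<Rightarrow> 'n ngen \<Rightarrow> 'n ball_coord diff_op" where
  "ball_action k NI = ball_op (\<lambda>c. 1) (\<lambda>l c. 0) (\<lambda>l m c. 0)"
| "ball_action k (Na i) = ball_op (\<lambda>c. 0) (\<lambda>l c. of_bool (l = i)) (\<lambda>l m c. 0)"
| "ball_action k (Nad i) = ball_op (\<lambda>c. c (Bz i)) (\<lambda>l c. c (Bw i l)) (\<lambda>l m c. 0)"
| "ball_action k (NKm i j) = ball_op (\<lambda>c. 0) (\<lambda>l c. 0)
     (\<lambda>l m c. (of_bool (l = i \<and> m = j) + of_bool (m = i \<and> l = j)) / 2)"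
| "ball_action k (NK0 i j) = ball_op (\<lambda>c. of_real k * of_bool (i = j))
     (\<lambda>l c. c (Bz i) * of_bool (l = j) / 2)
     (\<lambda>l m c. (c (Bw i l) * of_bool (m = j) + c (Bw i m) * of_bool (l = j)) / 2)"
| "ball_action k (NKp i j) = ball_op (\<lambda>c. c (Bz i) * c (Bz j) / 2 + 2 * of_real k * c (Bw i j))
     (\<lambda>l c. (c (Bz i) * c (Bw j l) + c (Bz j) * c (Bw i l)) / 2)
     (\<lambda>l m c. (c (Bw i l) * c (Bw j m) + c (Bw i m) * c (Bw j l)) / 2)"

definition ball_FC :: "(real \<Rightarrow> complex ^ 'n) \<Rightarrow> (real \<Rightarrow> complex ^ 'n ^ 'n)
    \<Rightarrow> real \<Rightarrow> 'n ball_coord \<Rightarrow> complex"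
  where "ball_FC \<eta> W t \<beta> =
    (case \<beta> of Bz i \<Rightarrow> (\<eta> t - W t *v vcnj (\<eta> t)) $ i | Bw i j \<Rightarrow> W t $ i $ j)"

definition ball_W_eq :: "complex ^ 'n ^ 'n \<Rightarrow> complex ^ 'n ^ 'n \<Rightarrow> complex ^ 'n ^ 'n
    \<Rightarrow> (real \<Rightarrow> complex ^ 'n ^ 'n) \<Rightarrow> real \<Rightarrow> bool"
  where "ball_W_eq \<epsilon>0 \<epsilon>p \<epsilon>m W \<tau> \<longleftrightarrow>
    msmult \<i> (dot W \<tau>) = \<epsilon>m + msym (W \<tau> ** \<epsilon>0) + W \<tau> ** \<epsilon>p ** W \<tau>"

definition ball_eta_eq :: "complex ^ 'n \<Rightarrow> complex ^ 'n ^ 'n \<Rightarrow> complex ^ 'n ^ 'n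
    \<Rightarrow> (real \<Rightarrow> complex ^ 'n) \<Rightarrow> real \<Rightarrow> bool"
  where "ball_eta_eq \<epsilon> \<epsilon>0 \<epsilon>m \<eta> \<tau> \<longleftrightarrow>
    \<i> *s dot \<eta> \<tau> = \<epsilon> + \<epsilon>m *v vcnj (\<eta> \<tau>) + (1/2) *s (transpose \<epsilon>0 *v \<eta> \<tau>)"

definition vblock :: "real ^ 'n \<Rightarrow> real ^ 'n \<Rightarrow> real ^ ('n::finite + 'n)"
  where "vblock u v = (\<chi> s. case s of Inl i \<Rightarrow> u $ i | Inr i \<Rightarrow> v $ i)"

definition mblock :: "real ^ 'n ^ 'n \<Rightarrow> real ^ 'n ^ 'n \<Rightarrow> real ^ 'n ^ 'n \<Rightarrow> real ^ 'n ^ 'n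
    \<Rightarrow> real ^ ('n::finite + 'n) ^ ('n + 'n)"
  where "mblock A B C D =
    (\<chi> s t. case s of
        Inl i \<Rightarrow> (case t of Inl j \<Rightarrow> A $ i $ j | Inr j \<Rightarrow> B $ i $ j)
      | Inr i \<Rightarrow> (case t of Inl j \<Rightarrow> C $ i $ j | Inr j \<Rightarrow> D $ i $ j))"

definition sp_algebra :: "(real ^ ('n::finite + 'n) ^ ('n + 'n)) set"
  where "sp_algebra = {X. let J = mblock 0 (mat 1) (- mat 1) 0 in transpose X ** J + J ** X = 0}"

definition h_r :: "real ^ 'n ^ 'n \<Rightarrow> real ^ 'n ^ 'n \<Rightarrow> real ^ 'n ^ 'n \<Rightarrow> real ^ 'n ^ 'n
    \<Rightarrow> real ^ ('n::finite + 'n) ^ ('n + 'n)"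
  where "h_r m n p q = mblock (n + q) (m - p) (m + p) (- n + q)"

definition ball_real_eq :: "real ^ 'n \<Rightarrow> real ^ 'n \<Rightarrow> real ^ 'n ^ 'n \<Rightarrow> real ^ 'n ^ 'n \<Rightarrow> real ^ 'n ^ 'n
    \<Rightarrow> real ^ 'n ^ 'n \<Rightarrow> (real \<Rightarrow> real ^ 'n) \<Rightarrow> (real \<Rightarrow> real ^ 'n) \<Rightarrow> real \<Rightarrow> bool"
  where "ball_real_eq a b m n p q \<xi> \<zeta> \<tau> \<longleftrightarrow>
    dot (\<lambda>t. vblock (\<xi> t) (\<zeta> t)) \<tau> = h_r m n p q *v vblock (\<xi> \<tau>) (\<zeta> \<tau>) + vblock a b"

text \<open>The generators for \<open>n = 1\<close> as generators of the Jacobi algebra.\<close>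

fun ngen_one :: "1 ngen \<Rightarrow> jgen" where
  "ngen_one NI = GI"
| "ngen_one (Na _) = Ga"
| "ngen_one (Nad _) = Gad"
| "ngen_one (NK0 _ _) = GK0"
| "ngen_one (NKp _ _) = GKp"
| "ngen_one (NKm _ _) = GKm"

text \<open>Differentiable curves in \<open>FC\<close>-coordinates.\<close>

definition disk_curve :: "real set \<Rightarrow> (real \<Rightarrow> complex) \<Rightarrow> (real \<Rightarrow> complex) \<Rightarrow> bool"
  where "disk_curve J \<eta> w \<longleftrightarrow>
    (\<forall>\<tau>\<in>J. \<eta> differentiable (at \<tau>) \<and> w differentiable (at \<tau>) \<and> w \<tau> \<in> siegel_disk)"

definition ball_curve :: "real set \<Rightarrow> (real \<Rightarrow> complex ^ 'n) \<Rightarrow> (real \<Rightarrow> complex ^ 'n ^ 'n) \<Rightarrow> bool"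
  where "ball_curve J \<eta> W \<longleftrightarrow>
    (\<forall>\<tau>\<in>J. \<eta> differentiable (at \<tau>) \<and> W differentiable (at \<tau>) \<and> W \<tau> \<in> siegel_ball)"

end

theory Submission
  imports Defs
begin

text \<open>On the Wei-Norman side, conjugation by the factors of \<open>T\<close> is computed explicitly: \<open>[A, _]\<close> is
  nilpotent on the Jacobi algebra for every factor \<open>exp A\<close> except the one generated by \<open>K\<^sub>0\<close>, where it
  is diagonal. Write \<open>Y\<close> and \<open>V\<close> for the defects (left minus right side) of the equations for
  \<open>\<eta>\<close> and \<open>w\<close>, and a star for entrywise conjugation. Up to nonzero factors the coefficients of \<open>K\<^sub>+\<close> and \<open>K\<^sub>-\<close> in \<open>E_hat\<close> are \<open>V\<close> and
  its conjugate, the coefficient of \<open>a\<^sup>\<dagger>\<close> is \<open>Y + w Y\<^sup>*\<close>, and that of \<open>a\<close> is then a multiple of \<open>Y\<^sup>*\<close>.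
  On the Berezin side, with \<open>z = \<eta> - W \<eta>\<^sup>*\<close>, the defect of the equation for \<open>z\<close> is
  \<open>Y + W Y\<^sup>* - V \<eta>\<^sup>*\<close>. In both cases \<open>V = 0\<close> and \<open>Y = - W Y\<^sup>*\<close>; then \<open>(1 - W W\<^sup>*) Y = 0\<close> gives
  \<open>Y = 0\<close>, because \<open>1 - W W\<^sup>*\<close> is positive definite.\<close>

section \<open>Exponentials in the Jacobi algebra\<close>

lemma UNIV_jgen: "(UNIV :: jgen set) = {GI, Ga, Gad, GK0, GKp, GKm}"
  using jgen.exhaust by blast

lemma sum_jgen: "sum f UNIV = f GI + f Ga + f Gad + f GK0 + f GKp + (f GKm :: 'a::comm_monoid_add)"
  by (simp add: UNIV_jgen add.assoc)

lemma all_jgen: "(\<forall>g. P g) \<longleftrightarrow> P GI \<and> P Ga \<and> P Gad \<and> P GK0 \<and> P GKp \<and> P GKm"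
  by (metis jgen.exhaust)

lemma gen_nth [simp]: "gen g $ h = of_bool (g = h)"
  by (simp add: gen_def axis_def)

text \<open>The commutator table is evaluated once, in coordinates; every later bracket computation
  rests on these six bilinear forms.\<close>

lemma jbracket_nth:
  "jbracket X Y $ GI = X $ Ga * Y $ Gad - X $ Gad * Y $ Ga"
  "jbracket X Y $ Ga = X $ GKm * Y $ Gad - X $ Gad * Y $ GKm - (X $ GK0 * Y $ Ga - X $ Ga * Y $ GK0) / 2"
  "jbracket X Y $ Gad = X $ Ga * Y $ GKp - X $ GKp * Y $ Ga + (X $ GK0 * Y $ Gad - X $ Gad * Y $ GK0) / 2"
  "jbracket X Y $ GK0 = 2 * (X $ GKm * Y $ GKp - X $ GKp * Y $ GKm)"
  "jbracket X Y $ GKp = X $ GK0 * Y $ GKp - X $ GKp * Y $ GK0"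
  "jbracket X Y $ GKm = X $ GKm * Y $ GK0 - X $ GK0 * Y $ GKm"
  by (simp_all add: jbracket_def sum_jgen) (simp_all add: diff_divide_distrib)

lemma jalg_eq_iff:
  "(X :: jalg) = Y \<longleftrightarrow> X $ GI = Y $ GI \<and> X $ Ga = Y $ Ga \<and> X $ Gad = Y $ Gad
     \<and> X $ GK0 = Y $ GK0 \<and> X $ GKp = Y $ GKp \<and> X $ GKm = Y $ GKm"
  by (simp add: vec_eq_iff all_jgen)

lemma jbracket_zero_right: "jbracket A 0 = 0"
  by (simp add: jalg_eq_iff jbracket_nth)

lemma funpow_jbracket_eq_0:
  assumes "(jbracket A ^^ N) X = 0" "N \<le> n"
  shows "(jbracket A ^^ n) X = 0"
  using assms(2) by (induction rule: dec_induct) (simp_all add: assms(1) jbracket_zero_right)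

text \<open>All terms from \<open>N\<close> on vanish, so the series is a finite sum.\<close>

lemma exp_ad_nilpotent:
  assumes "(jbracket A ^^ N) X = 0"
  shows "exp_ad A X = (\<Sum>n<N. (1 / fact n) *\<^sub>R (jbracket A ^^ n) X)"
  unfolding exp_ad_def using funpow_jbracket_eq_0[OF assms]
  by (intro suminf_finite) auto

lemma exp_logderiv_nilpotent:
  assumes "(jbracket A ^^ N) A' = 0"
  shows "exp_logderiv A A' = (\<Sum>n<N. ((- 1) ^ n / fact (Suc n)) *\<^sub>R (jbracket A ^^ n) A')"
  unfolding exp_logderiv_def using funpow_jbracket_eq_0[OF assms]
  by (intro suminf_finite) auto

text \<open>This covers every factor of \<open>T\<close> but the one along K_0: a Heisenberg element
  sends the K's to combinations of a and \<open>a\<^sup>\<dagger>\<close>, these to I and I to 0;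
  K_+ moves K_- to K_0 to K_+ to 0, and K_- goes the other way.\<close>

lemma exp_ad_nilpotent_3:
  assumes "jbracket A (jbracket A (jbracket A X)) = 0"
  shows "exp_ad A X $ g = X $ g + jbracket A X $ g + jbracket A (jbracket A X) $ g / 2"
  using exp_ad_nilpotent[where A = A and N = 3 and X = X] assms
  by (simp add: eval_nat_numeral scaleR_conv_of_real[where 'a = complex])

text \<open>In use \<open>d\<close> is the conjugate of \<open>c\<close>. Conjugation by the inverse
  of a factor brackets with \<open>- A\<close>, while \<open>exp_logderiv\<close> brackets with
  \<open>A\<close>; hence both signs.\<close>

lemma jbracket_Heisenberg_nth:
  fixes c d :: complex and X :: jalg
  defines "A \<equiv> c *s gen Gad - d *s gen Ga"
  shows "jbracket (- A) X $ GI = d * X $ Gad + c * X $ Ga"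
    and "jbracket (- A) X $ Ga = c * X $ GKm + d * X $ GK0 / 2"
    and "jbracket (- A) X $ Gad = d * X $ GKp + c * X $ GK0 / 2"
    and "jbracket (- A) X $ GK0 = 0" "jbracket (- A) X $ GKp = 0" "jbracket (- A) X $ GKm = 0"
    and "jbracket A X $ GI = - d * X $ Gad - c * X $ Ga"
    and "jbracket A X $ Ga = - c * X $ GKm - d * X $ GK0 / 2"
    and "jbracket A X $ Gad = - d * X $ GKp - c * X $ GK0 / 2"
    and "jbracket A X $ GK0 = 0" "jbracket A X $ GKp = 0" "jbracket A X $ GKm = 0"
  by (simp_all add: A_def jbracket_nth)

lemma jbracket_GKp_nth:
  fixes c :: complex and X :: jalg
  shows "jbracket (- (c *s gen GKp)) X $ GI = 0"
    and "jbracket (- (c *s gen GKp)) X $ Ga = 0"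
    and "jbracket (- (c *s gen GKp)) X $ Gad = c * X $ Ga"
    and "jbracket (- (c *s gen GKp)) X $ GK0 = 2 * c * X $ GKm"
    and "jbracket (- (c *s gen GKp)) X $ GKp = c * X $ GK0"
    and "jbracket (- (c *s gen GKp)) X $ GKm = 0"
  by (simp_all add: jbracket_nth)

text \<open>The last factor of \<open>S\<close> has exponent \<open>(- cnj w) *s gen GKm\<close>, so
  for conjugation by its inverse the two signs cancel; the formulas for K_+ keep theirs.\<close>

lemma jbracket_GKm_nth:
  fixes c :: complex and X :: jalg
  shows "jbracket (c *s gen GKm) X $ GI = 0"
    and "jbracket (c *s gen GKm) X $ Ga = c * X $ Gad"
    and "jbracket (c *s gen GKm) X $ Gad = 0"
    and "jbracket (c *s gen GKm) X $ GK0 = 2 * c * X $ GKp"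
    and "jbracket (c *s gen GKm) X $ GKp = 0"
    and "jbracket (c *s gen GKm) X $ GKm = c * X $ GK0"
  by (simp_all add: jbracket_nth)

text \<open>A double bracket with a Heisenberg element is a multiple of I, so on the other
  generators the series stops at first order.\<close>

lemma exp_ad_Heisenberg_nth:
  fixes c d :: complex and X :: jalg
  defines "Y \<equiv> exp_ad (- (c *s gen Gad - d *s gen Ga)) X"
  shows "Y $ Ga = X $ Ga + c * X $ GKm + d * X $ GK0 / 2"
    and "Y $ Gad = X $ Gad + d * X $ GKp + c * X $ GK0 / 2"
    and "Y $ GK0 = X $ GK0" and "Y $ GKp = X $ GKp" and "Y $ GKm = X $ GKm"
  unfolding Y_def
  \<comment> \<open>\<open>minus_diff_eq\<close> would turn the negated difference around and hide
    the pattern of \<open>jbracket_Heisenberg_nth\<close>.\<close>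
  by (simp_all add: exp_ad_nilpotent_3 jbracket_Heisenberg_nth jalg_eq_iff del: minus_diff_eq)

lemma exp_ad_GKp_nth:
  fixes w :: complex and X :: jalg
  defines "Y \<equiv> exp_ad (- (w *s gen GKp)) X"
  shows "Y $ Ga = X $ Ga" and "Y $ Gad = X $ Gad + w * X $ Ga"
    and "Y $ GK0 = X $ GK0 + 2 * w * X $ GKm"
    and "Y $ GKp = X $ GKp + w * X $ GK0 + w\<^sup>2 * X $ GKm"
    and "Y $ GKm = X $ GKm"
  unfolding Y_def
  by (simp_all add: exp_ad_nilpotent_3 jbracket_GKp_nth jalg_eq_iff power2_eq_square)

lemma exp_ad_GKm_nth:
  fixes v :: complex and X :: jalg
  defines "Y \<equiv> exp_ad (v *s gen GKm) X"
  shows "Y $ Ga = X $ Ga + v * X $ Gad" and "Y $ Gad = X $ Gad"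
    and "Y $ GK0 = X $ GK0 + 2 * v * X $ GKp"
    and "Y $ GKp = X $ GKp"
    and "Y $ GKm = X $ GKm + v * X $ GK0 + v\<^sup>2 * X $ GKp"
  unfolding Y_def
  by (simp_all add: exp_ad_nilpotent_3 jbracket_GKm_nth jalg_eq_iff power2_eq_square)

text \<open>The eigenvalues of \<open>[K\<^sub>0, _]\<close> on the generators.\<close>

fun K0_weight :: "jgen \<Rightarrow> complex" where
  "K0_weight Gad = 1/2" | "K0_weight Ga = -1/2" | "K0_weight GKp = 1" | "K0_weight GKm = -1"
| "K0_weight _ = 0"

lemma jbracket_GK0_nth: "jbracket (- (c *s gen GK0)) X $ g = - c * K0_weight g * X $ g"
  by (cases g) (simp_all add: jbracket_nth)

text \<open>Here the bracket is diagonal, so each coordinate carries a scalar exponential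
  series.\<close>

lemma exp_ad_GK0_nth: "exp_ad (- (c *s gen GK0)) X $ g = exp (- c * K0_weight g) * X $ g"
proof -
  let ?B = "jbracket (- (c *s gen GK0))"
  have pow: "(?B ^^ n) X $ h = (- c * K0_weight h) ^ n * X $ h" for n h
    by (induction n) (simp_all add: jbracket_GK0_nth)
  have "(\<lambda>n. ((1 / fact n) *\<^sub>R (?B ^^ n) X) $ h) sums (exp (- c * K0_weight h) * X $ h)" for h
    using sums_mult2[OF exp_converges[of "- c * K0_weight h"], of "X $ h"]
    by (simp add: pow divide_inverse scaleR_conv_of_real[where 'a = complex] mult.assoc)
  \<comment> \<open>Convergence of vectors is convergence of each coordinate.\<close>
  then have "(\<lambda>n. (1 / fact n) *\<^sub>R (?B ^^ n) X) sums (\<chi> h. exp (- c * K0_weight h) * X $ h)"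
    unfolding sums_def by (intro vec_tendstoI) simp
  then show ?thesis
    by (simp add: exp_ad_def sums_iff)
qed

lemma exp_logderiv_parallel:
  assumes "jbracket A A' = 0"
  shows "exp_logderiv A A' = A'"
  using exp_logderiv_nilpotent[where A = A and N = 1 and A' = A'] assms by simp

text \<open>The bracket of \<open>A\<close> and \<open>A'\<close> is central: the series stops after
  two terms, and the correction to the velocity affects the coefficient of I only.\<close>

lemma exp_logderiv_Heisenberg_nth:
  fixes c d c' d' :: complex
  defines "Y \<equiv> exp_logderiv (c *s gen Gad - d *s gen Ga) (c' *s gen Gad - d' *s gen Ga)"
  shows "Y $ Ga = - d'" and "Y $ Gad = c'"
    and "Y $ GK0 = 0" and "Y $ GKp = 0" and "Y $ GKm = 0"
proof -
  let ?A = "c *s gen Gad - d *s gen Ga" and ?A' = "c' *s gen Gad - d' *s gen Ga"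
  have "jbracket ?A (jbracket ?A ?A') = 0"
    by (simp add: jalg_eq_iff jbracket_Heisenberg_nth)
  then have "Y = ?A' - (1 / 2) *\<^sub>R jbracket ?A ?A'"
    using exp_logderiv_nilpotent[where A = ?A and N = 2 and A' = ?A']
    by (simp add: Y_def eval_nat_numeral)
  then show "Y $ Ga = - d'" and "Y $ Gad = c'"
    and "Y $ GK0 = 0" and "Y $ GKp = 0" and "Y $ GKm = 0"
    by (simp_all add: jbracket_Heisenberg_nth)
qed

section \<open>The Wei-Norman equations\<close>

text \<open>The scalar \<open>s\<close> is the square root of \<open>D\<close>. The coefficient of a
  is left in a form that shows what remains once the coefficient of \<open>a\<^sup>\<dagger>\<close>
  vanishes: the nonzero multiple \<open>s\<close> of the original one.\<close>

lemma conj_by_S_nth: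
  fixes w :: complex and X :: jalg
  assumes w: "cmod w < 1"
  defines "D \<equiv> 1 - (cmod w)\<^sup>2"
  defines "s \<equiv> complex_of_real (exp (ln D / 2))"
  defines "Y \<equiv> conj_by [w *s gen GKp, complex_of_real (ln D) *s gen GK0, (- cnj w) *s gen GKm] X"
  shows "Y $ Gad = (X $ Gad + w * X $ Ga) / s"
    and "Y $ Ga = s * X $ Ga + cnj w * (X $ Gad + w * X $ Ga) / s"
    and "Y $ GKp = (X $ GKp + w * X $ GK0 + w\<^sup>2 * X $ GKm) / D"
    and "Y $ GKm = (X $ GKm + cnj w * X $ GK0 + (cnj w)\<^sup>2 * X $ GKp) / D"
proof -
  have D: "D > 0"
    using w by (simp add: D_def abs_square_less_1)
  have cD: "complex_of_real D = 1 - w * cnj w"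
    by (simp add: D_def complex_norm_square[symmetric])
  have nz: "1 - w * cnj w \<noteq> 0"
    using D cD by (metis less_irrefl of_real_eq_0_iff)
  have e1: "exp (complex_of_real (ln D) / 2) = s"
    using exp_of_real[of "ln D / 2", where 'a = complex] by (simp add: s_def)
  \<comment> \<open>The scalars by which the K_0 factor acts on \<open>Ga\<close>,
    \<open>Gad\<close>, \<open>GKm\<close> and \<open>GKp\<close>, in this order.\<close>
  have e: "exp (complex_of_real (ln D) / 2) = s" "exp (- (complex_of_real (ln D) / 2)) = 1 / s"
      "exp (complex_of_real (ln D)) = D" "exp (- complex_of_real (ln D)) = 1 / D"
    using D by (simp_all add: e1 exp_minus inverse_eq_divide exp_of_real)
  have s: "s \<noteq> 0"
    by (simp add: s_def)
  show "Y $ Gad = (X $ Gad + w * X $ Ga) / s"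
    and "Y $ Ga = s * X $ Ga + cnj w * (X $ Gad + w * X $ Ga) / s"
    and "Y $ GKp = (X $ GKp + w * X $ GK0 + w\<^sup>2 * X $ GKm) / D"
    using s unfolding Y_def by (simp_all add: exp_ad_GKp_nth exp_ad_GK0_nth exp_ad_GKm_nth e)
  have "Y $ GKm = D * X $ GKm + cnj w * (X $ GK0 + 2 * w * X $ GKm)
      + (cnj w)\<^sup>2 * ((X $ GKp + w * X $ GK0 + w\<^sup>2 * X $ GKm) / D)"
    unfolding Y_def by (simp add: exp_ad_GKp_nth exp_ad_GK0_nth exp_ad_GKm_nth e)
  \<comment> \<open>With u = w * cnj w and D + u = 1, the factor of \<open>X $ GKm\<close> is D + 2u
    + u^2/D = (D + u)^2/D = 1/D; that of \<open>X $ GK0\<close> collapses likewise.\<close>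
  also have "\<dots> = (X $ GKm + cnj w * X $ GK0 + (cnj w)\<^sup>2 * X $ GKp) / D"
    using nz unfolding cD by (simp add: field_simps power2_eq_square)
  finally show "Y $ GKm = (X $ GKm + cnj w * X $ GK0 + (cnj w)\<^sup>2 * X $ GKp) / D" .
qed

section \<open>Velocities of the factors of \<open>T\<close> and the coefficients of
  \<open>E_hat\<close>\<close>

lemma has_vector_derivative_vec_smult:
  assumes "(f has_vector_derivative f') (at \<tau>)"
  shows "((\<lambda>t. f t *s v) has_vector_derivative f' *s (v :: complex ^ 'n)) (at \<tau>)"
proof -
  have "bounded_linear (\<lambda>c. c *s v)"
    unfolding linear_conv_bounded_linear[symmetric]
    by (intro linearI) (simp_all add: vec_eq_iff algebra_simps)
  from bounded_linear.has_vector_derivative[OF this assms] show ?thesis .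
qed

text \<open>The squared modulus is differentiated through real and imaginary parts, and twice the
  real part of w' * cnj w is then rewritten as a sum of two conjugate terms.\<close>

lemma has_vector_derivative_ln_disk:
  assumes w: "(w has_vector_derivative w') (at \<tau>)" and "cmod (w \<tau>) < 1"
  shows "((\<lambda>t. complex_of_real (ln (1 - (cmod (w t))\<^sup>2))) has_vector_derivative
     - (w' * cnj (w \<tau>) + w \<tau> * cnj w') / of_real (1 - (cmod (w \<tau>))\<^sup>2)) (at \<tau>)"
proof -
  have D: "1 - (cmod (w \<tau>))\<^sup>2 > 0"
    using assms(2) by (simp add: abs_square_less_1)
  have ReIm: "((\<lambda>t. Re (w t)) has_real_derivative Re w') (at \<tau>)"
      "((\<lambda>t. Im (w t)) has_real_derivative Im w') (at \<tau>)"
    using bounded_linear.has_vector_derivative[OF bounded_linear_Re w]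
      bounded_linear.has_vector_derivative[OF bounded_linear_Im w]
    by (simp_all add: has_real_derivative_iff_has_vector_derivative)
  have "((\<lambda>t. ln (1 - (cmod (w t))\<^sup>2)) has_real_derivative
      - 2 * (Re (w \<tau>) * Re w' + Im (w \<tau>) * Im w') / (1 - (cmod (w \<tau>))\<^sup>2)) (at \<tau>)"
    using D unfolding cmod_power2
    by (auto intro!: derivative_eq_intros ReIm w simp: field_simps)
  then have "((\<lambda>t. complex_of_real (ln (1 - (cmod (w t))\<^sup>2))) has_vector_derivative
      of_real (- 2 * (Re (w \<tau>) * Re w' + Im (w \<tau>) * Im w') / (1 - (cmod (w \<tau>))\<^sup>2))) (at \<tau>)"
    by (intro bounded_linear.has_vector_derivative[OF bounded_linear_of_real])
      (simp add: has_real_derivative_iff_has_vector_derivative)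
  moreover have "of_real (- 2 * (Re (w \<tau>) * Re w' + Im (w \<tau>) * Im w'))
      = - (w' * cnj (w \<tau>) + w \<tau> * cnj w')"
    by (simp add: complex_eq_iff algebra_simps)
  ultimately show ?thesis
    by (simp only: of_real_divide)
qed

text \<open>\<open>X\<close> and \<open>Y\<close> are the coefficients of a and
  \<open>a\<^sup>\<dagger>\<close> contributed by \<open>D(\<eta>)\<close>, before conjugation by
  \<open>S\<close>. For Hermitian \<open>H\<close> they are conjugate to each other.\<close>

lemma E_hat_nth:
  fixes \<eta> w :: "real \<Rightarrow> complex" and H :: jalg
  assumes \<eta>: "(\<eta> has_vector_derivative \<eta>') (at \<tau>)" and w: "(w has_vector_derivative w') (at \<tau>)"
    and w1: "cmod (w \<tau>) < 1"
  defines "D \<equiv> 1 - (cmod (w \<tau>))\<^sup>2"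
  defines "s \<equiv> complex_of_real (exp (ln D / 2))"
  defines "X \<equiv> - \<i> * cnj \<eta>' - (H $ Ga + \<eta> \<tau> * H $ GKm + cnj (\<eta> \<tau>) * H $ GK0 / 2)"
  defines "Y \<equiv> \<i> * \<eta>' - (H $ Gad + cnj (\<eta> \<tau>) * H $ GKp + \<eta> \<tau> * H $ GK0 / 2)"
  shows "E_hat H \<phi> \<eta> w \<tau> $ Gad = (Y + w \<tau> * X) / s"
    and "E_hat H \<phi> \<eta> w \<tau> $ Ga = s * X + cnj (w \<tau>) * (Y + w \<tau> * X) / s"
    and "E_hat H \<phi> \<eta> w \<tau> $ GKp = (\<i> * w' - (H $ GKp + w \<tau> * H $ GK0 + (w \<tau>)\<^sup>2 * H $ GKm)) / D"
    and "E_hat H \<phi> \<eta> w \<tau> $ GKm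
      = (- \<i> * cnj w' - (H $ GKm + cnj (w \<tau>) * H $ GK0 + (cnj (w \<tau>))\<^sup>2 * H $ GKp)) / D"
proof -
  have D: "D > 0"
    using w1 by (simp add: D_def abs_square_less_1)
  have cD: "complex_of_real D = 1 - w \<tau> * cnj (w \<tau>)"
    by (simp add: D_def complex_norm_square[symmetric])
  have nz: "1 - w \<tau> * cnj (w \<tau>) \<noteq> 0"
    using D cD by (metis less_irrefl of_real_eq_0_iff)
  have s: "s \<noteq> 0"
    by (simp add: s_def)
  have e1: "exp (complex_of_real (ln D) / 2) = s"
    using exp_of_real[of "ln D / 2", where 'a = complex] by (simp add: s_def)
  have e: "exp (complex_of_real (ln D) / 2) = s" "exp (- (complex_of_real (ln D) / 2)) = 1 / s"
      "exp (complex_of_real (ln D)) = D" "exp (- complex_of_real (ln D)) = 1 / D"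
    using D by (simp_all add: e1 exp_minus inverse_eq_divide exp_of_real)
  define L' where "L' = - (w' * cnj (w \<tau>) + w \<tau> * cnj w') / of_real D"
  have dots:
    "dot (\<lambda>t. \<eta> t *s gen Gad - cnj (\<eta> t) *s gen Ga) \<tau> = \<eta>' *s gen Gad - cnj \<eta>' *s gen Ga"
    "dot (\<lambda>t. w t *s gen GKp) \<tau> = w' *s gen GKp"
    "dot (\<lambda>t. complex_of_real (ln (1 - (cmod (w t))\<^sup>2)) *s gen GK0) \<tau> = L' *s gen GK0"
    "dot (\<lambda>t. (- cnj (w t)) *s gen GKm) \<tau> = (- cnj w') *s gen GKm"
    unfolding L'_def D_def
    by (intro vector_derivative_at has_vector_derivative_diff has_vector_derivative_vec_smult
        has_vector_derivative_minus has_vector_derivative_ln_disk \<eta> w w1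
        bounded_linear.has_vector_derivative[OF bounded_linear_cnj])+
  \<comment> \<open>A factor along a single generator commutes with its velocity.\<close>
  have par: "exp_logderiv (c *s gen g) (c' *s gen g) = c' *s gen g" for c c' g
    by (rule exp_logderiv_parallel)
      (cases g; simp add: jalg_eq_iff jbracket_nth)
  let ?S = "conj_by [w \<tau> *s gen GKp, complex_of_real (ln D) *s gen GK0, (- cnj (w \<tau>)) *s gen GKm]"
  let ?A = "\<eta> \<tau> *s gen Gad - cnj (\<eta> \<tau>) *s gen Ga"
  \<comment> \<open>Leibniz rule: each velocity is conjugated by the factors to its right, so the
    contribution of \<open>D(\<eta>)\<close> and the Hamiltonian both pass through all of
    \<open>S\<close>.\<close>
  have E: "E_hat H \<phi> \<eta> w \<tau> $ g
    = of_real (dot \<phi> \<tau>) * gen GI $ g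
      + \<i> * (?S (exp_logderiv ?A (\<eta>' *s gen Gad - cnj \<eta>' *s gen Ga)) $ g
        + conj_by [complex_of_real (ln D) *s gen GK0, (- cnj (w \<tau>)) *s gen GKm] (w' *s gen GKp) $ g
        + conj_by [(- cnj (w \<tau>)) *s gen GKm] (L' *s gen GK0) $ g
        - cnj w' * gen GKm $ g)
      - ?S (exp_ad (- ?A) H) $ g" for g
    unfolding E_hat_def T_factors_def logderiv.simps list.map conj_by.simps dots par D_def[symmetric]
    by (simp add: algebra_simps)
  \<comment> \<open>All three factors of \<open>S\<close> contribute to K_-. Inserting
    \<open>L'\<close> cancels the terms in w', and D + w * cnj w = 1 combines the rest.\<close>
  have Km: "(cnj (w \<tau>))\<^sup>2 * w' / D + cnj (w \<tau>) * L' - cnj w' = - cnj w' / D"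
    using nz unfolding L'_def cD by (simp add: field_simps power2_eq_square)
  note S = conj_by_S_nth[OF w1, folded D_def, folded s_def]
  note C = exp_logderiv_Heisenberg_nth exp_ad_Heisenberg_nth
  note K = exp_ad_GK0_nth exp_ad_GKm_nth
  \<comment> \<open>The span of the K's is stable under conjugation by \<open>S\<close>, so the
    velocities of the factors of \<open>S\<close> add nothing to a and
    \<open>a\<^sup>\<dagger>\<close>.\<close>
  show "E_hat H \<phi> \<eta> w \<tau> $ Gad = (Y + w \<tau> * X) / s"
    unfolding E S C using s by (simp add: K X_def Y_def field_simps)
  show "E_hat H \<phi> \<eta> w \<tau> $ Ga = s * X + cnj (w \<tau>) * (Y + w \<tau> * X) / s"
    unfolding E S C using s by (simp add: K X_def Y_def field_simps)
  show "E_hat H \<phi> \<eta> w \<tau> $ GKp = (\<i> * w' - (H $ GKp + w \<tau> * H $ GK0 + (w \<tau>)\<^sup>2 * H $ GKm)) / D"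
    unfolding E S C using D by (simp add: K e diff_divide_distrib)
  have "E_hat H \<phi> \<eta> w \<tau> $ GKm = \<i> * ((cnj (w \<tau>))\<^sup>2 * w' / D + cnj (w \<tau>) * L' - cnj w')
      - (H $ GKm + cnj (w \<tau>) * H $ GK0 + (cnj (w \<tau>))\<^sup>2 * H $ GKp) / D"
    unfolding E S C by (simp add: K e)
  then show "E_hat H \<phi> \<eta> w \<tau> $ GKm
      = (- \<i> * cnj w' - (H $ GKm + cnj (w \<tau>) * H $ GK0 + (cnj (w \<tau>))\<^sup>2 * H $ GKp)) / D"
    unfolding Km by (simp add: diff_divide_distrib)
qed

lemma H0_nth:
  "H0 \<epsilon>a \<epsilon>0 \<epsilon>p \<epsilon>m $ GI = 0" "H0 \<epsilon>a \<epsilon>0 \<epsilon>p \<epsilon>m $ Ga = \<epsilon>a" "H0 \<epsilon>a \<epsilon>0 \<epsilon>p \<epsilon>m $ Gad = cnj \<epsilon>a"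
  "H0 \<epsilon>a \<epsilon>0 \<epsilon>p \<epsilon>m $ GK0 = \<epsilon>0" "H0 \<epsilon>a \<epsilon>0 \<epsilon>p \<epsilon>m $ GKp = \<epsilon>p" "H0 \<epsilon>a \<epsilon>0 \<epsilon>p \<epsilon>m $ GKm = \<epsilon>m"
  by (simp_all add: H0_def)

text \<open>Compare norms: \<open>Y\<close> and \<open>w * cnj Y\<close> have the same one.\<close>

lemma eq_0_if_add_mult_cnj_eq_0:
  assumes "Y + w * cnj Y = 0" "cmod w < 1"
  shows "Y = 0"
proof (rule ccontr)
  assume "Y \<noteq> 0"
  have "cmod Y = cmod w * cmod Y"
    using arg_cong[OF assms(1)[unfolded add_eq_0_iff2], of cmod] by (simp add: norm_mult)
  with \<open>Y \<noteq> 0\<close> assms(2) show False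
    by simp
qed

lemma wei_norman_eqs_iff:
  assumes \<eta>: "\<eta> differentiable (at \<tau>)" and w: "w differentiable (at \<tau>)"
    and w1: "cmod (w \<tau>) < 1" and herm: "hermitian_coeffs \<epsilon>0 \<epsilon>p \<epsilon>m"
  shows "wei_norman_eqs (H0 \<epsilon>a \<epsilon>0 \<epsilon>p \<epsilon>m) \<phi> \<eta> w \<tau> \<longleftrightarrow>
    wn_w_eq \<epsilon>0 \<epsilon>p \<epsilon>m w \<tau> \<and> wn_eta_eq \<epsilon>a \<epsilon>0 \<epsilon>p \<eta> \<tau>"
proof -
  define Y where "Y = \<i> * dot \<eta> \<tau> - (cnj \<epsilon>a + cnj (\<eta> \<tau>) * \<epsilon>p + \<eta> \<tau> * \<epsilon>0 / 2)"
  define V where "V = \<i> * dot w \<tau> - (\<epsilon>p + w \<tau> * \<epsilon>0 + (w \<tau>)\<^sup>2 * \<epsilon>m)"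
  define D where "D = 1 - (cmod (w \<tau>))\<^sup>2"
  have h: "cnj \<epsilon>0 = \<epsilon>0" "\<epsilon>m = cnj \<epsilon>p"
    using herm by (simp_all add: hermitian_coeffs_def)
  \<comment> \<open>Hermiticity makes the expressions for a and K_- the conjugates of those for
    \<open>a\<^sup>\<dagger>\<close> and K_+.\<close>
  have cnj_Y: "cnj Y = - \<i> * cnj (dot \<eta> \<tau>) - (\<epsilon>a + \<eta> \<tau> * \<epsilon>m + cnj (\<eta> \<tau>) * \<epsilon>0 / 2)"
    and cnj_V: "cnj V = - \<i> * cnj (dot w \<tau>) - (\<epsilon>m + cnj (w \<tau>) * \<epsilon>0 + (cnj (w \<tau>))\<^sup>2 * \<epsilon>p)"
    by (simp_all add: Y_def V_def h)
  have "D \<noteq> 0"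
    using w1 by (simp add: D_def abs_square_eq_1)
  note E = E_hat_nth[OF vector_derivative_works[THEN iffD1, OF \<eta>]
      vector_derivative_works[THEN iffD1, OF w] w1, of "H0 \<epsilon>a \<epsilon>0 \<epsilon>p \<epsilon>m" \<phi>,
      unfolded H0_nth, folded Y_def V_def cnj_Y cnj_V D_def]
  \<comment> \<open>The equation for \<open>a\<^sup>\<dagger>\<close> is Y + w * cnj Y = 0; given
    it, the one for a reduces to s * cnj Y = 0. Those for K_+ and K_- both say V = 0.\<close>
  have "wei_norman_eqs (H0 \<epsilon>a \<epsilon>0 \<epsilon>p \<epsilon>m) \<phi> \<eta> w \<tau> \<longleftrightarrow> Y + w \<tau> * cnj Y = 0 \<and> Y = 0 \<and> V = 0"
    unfolding wei_norman_eqs_def using \<open>D \<noteq> 0\<close> by (auto simp: E)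
  also have "\<dots> \<longleftrightarrow> Y = 0 \<and> V = 0"
    by auto
  also have "\<dots> \<longleftrightarrow> wn_w_eq \<epsilon>0 \<epsilon>p \<epsilon>m w \<tau> \<and> wn_eta_eq \<epsilon>a \<epsilon>0 \<epsilon>p \<eta> \<tau>"
    by (auto simp: Y_def V_def wn_w_eq_def wn_eta_eq_def mult_ac)
  finally show ?thesis .
qed

section \<open>Berezin's equations on the disk\<close>

text \<open>The change of variables involves cnj \<eta>, so the equation for z mixes the defect of
  the \<eta>-equation with its conjugate; the w-equation removes \<open>V\<close>, and |w| < 1
  separates the rest.\<close>

lemma berezin_eqs_disk_FC_iff:
  assumes \<eta>: "\<eta> differentiable (at \<tau>)" and w: "w differentiable (at \<tau>)"
    and w1: "cmod (w \<tau>) < 1" and herm: "hermitian_coeffs \<epsilon>0 \<epsilon>p \<epsilon>m"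
  shows "berezin_eqs (disk_action k) (H0 \<epsilon>a \<epsilon>0 \<epsilon>p \<epsilon>m) (disk_FC \<eta> w) \<tau> \<longleftrightarrow>
    \<i> * dot \<eta> \<tau> = \<epsilon>a + \<epsilon>m * cnj (\<eta> \<tau>) + \<epsilon>0 / 2 * \<eta> \<tau> \<and>
    \<i> * dot w \<tau> = \<epsilon>m + \<epsilon>0 * w \<tau> + \<epsilon>p * (w \<tau>)\<^sup>2"
proof -
  define Y where "Y = \<i> * dot \<eta> \<tau> - (\<epsilon>a + \<epsilon>m * cnj (\<eta> \<tau>) + \<epsilon>0 / 2 * \<eta> \<tau>)"
  define V where "V = \<i> * dot w \<tau> - (\<epsilon>m + \<epsilon>0 * w \<tau> + \<epsilon>p * (w \<tau>)\<^sup>2)"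
  define z where "z = \<eta> \<tau> - w \<tau> * cnj (\<eta> \<tau>)"
  have h: "cnj \<epsilon>0 = \<epsilon>0" "\<epsilon>m = cnj \<epsilon>p"
    using herm by (simp_all add: hermitian_coeffs_def)
  have "((\<lambda>t. \<eta> t - w t * cnj (\<eta> t)) has_vector_derivative
      dot \<eta> \<tau> - (w \<tau> * cnj (dot \<eta> \<tau>) + dot w \<tau> * cnj (\<eta> \<tau>))) (at \<tau>)"
    by (intro has_vector_derivative_diff has_vector_derivative_mult
        bounded_linear.has_vector_derivative[OF bounded_linear_cnj]
        vector_derivative_works[THEN iffD1, OF \<eta>] vector_derivative_works[THEN iffD1, OF w])
  then have dz: "dot (\<lambda>t. \<eta> t - w t * cnj (\<eta> t)) \<tau>
      = dot \<eta> \<tau> - (w \<tau> * cnj (dot \<eta> \<tau>) + dot w \<tau> * cnj (\<eta> \<tau>))"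
    by (rule vector_derivative_at)
  have all_coord: "(\<forall>\<beta>. P \<beta>) \<longleftrightarrow> P Cz \<and> P Cw" for P
    by (metis disk_coord.exhaust)
  have "berezin_eqs (disk_action k) (H0 \<epsilon>a \<epsilon>0 \<epsilon>p \<epsilon>m) (disk_FC \<eta> w) \<tau> \<longleftrightarrow>
      \<i> * dot (\<lambda>t. \<eta> t - w t * cnj (\<eta> t)) \<tau>
        = \<epsilon>a + cnj \<epsilon>a * w \<tau> + \<epsilon>0 * (z / 2) + \<epsilon>p * (z * w \<tau>) \<and>
      \<i> * dot w \<tau> = \<epsilon>0 * w \<tau> + \<epsilon>p * (w \<tau>)\<^sup>2 + \<epsilon>m"
    by (simp add: berezin_eqs_def all_coord sum_jgen H0_nth disk_op_def disk_FC_def z_def)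
  also have "\<dots> \<longleftrightarrow> Y + w \<tau> * cnj Y - V * cnj (\<eta> \<tau>) = 0 \<and> V = 0"
  proof (rule arg_cong2[where f = "(\<and>)"])
    have "\<i> * dot (\<lambda>t. \<eta> t - w t * cnj (\<eta> t)) \<tau>
        - (\<epsilon>a + cnj \<epsilon>a * w \<tau> + \<epsilon>0 * (z / 2) + \<epsilon>p * (z * w \<tau>))
        = Y + w \<tau> * cnj Y - V * cnj (\<eta> \<tau>)"
      unfolding dz by (simp add: Y_def V_def z_def h algebra_simps diff_divide_distrib power2_eq_square)
    then show "(\<i> * dot (\<lambda>t. \<eta> t - w t * cnj (\<eta> t)) \<tau>
        = \<epsilon>a + cnj \<epsilon>a * w \<tau> + \<epsilon>0 * (z / 2) + \<epsilon>p * (z * w \<tau>))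
        = (Y + w \<tau> * cnj Y - V * cnj (\<eta> \<tau>) = 0)"
      by (subst eq_iff_diff_eq_0) (rule arg_cong[where f = "\<lambda>x. x = 0"])
  qed (simp add: V_def add_ac)
  also have "\<dots> \<longleftrightarrow> Y = 0 \<and> V = 0"
    using eq_0_if_add_mult_cnj_eq_0[OF _ w1, of Y] by auto
  finally show ?thesis
    by (simp add: Y_def V_def)
qed

section \<open>Real coordinates for the disk equations\<close>

text \<open>The factor 1/(2i) in \<open>K2\<close> gives K_+ the coefficient e1 - i e2 and K_- its
  conjugate.\<close>

lemma H0_eq_H0_real:
  "H0 (Complex \<nu>1 \<nu>2) (of_real (2 * e0)) (Complex e1 (- e2)) (cnj (Complex e1 (- e2)))
    = H0_real e0 e1 e2 \<nu>1 \<nu>2"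
  by (simp add: jalg_eq_iff H0_nth H0_real_def N1_def N2_def K1_def K2_def complex_eq_iff)

lemma has_vector_derivative_Complex:
  assumes "x differentiable (at \<tau>)" "y differentiable (at \<tau>)"
  shows "((\<lambda>t. Complex (x t) (y t)) has_vector_derivative Complex (dot x \<tau>) (dot y \<tau>)) (at \<tau>)"
  using assms unfolding Complex_eq
  by (auto intro!: derivative_eq_intros
      simp: vector_derivative_works has_real_derivative_iff_has_vector_derivative)

text \<open>Because of the factor i on the left, the real part is the equation for y and the
  imaginary part that for x.\<close>

lemma wn_eta_eq_real:
  assumes "x differentiable (at \<tau>)" "y differentiable (at \<tau>)"
  shows "wn_eta_eq (Complex \<nu>1 \<nu>2) (of_real (2 * e0)) (Complex e1 (- e2)) (\<lambda>t. Complex (x t) (y t)) \<tau>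
    \<longleftrightarrow> wn_xy_eq e0 e1 e2 \<nu>1 \<nu>2 x y \<tau>"
  by (auto simp: wn_eta_eq_def wn_xy_eq_def vector_derivative_at[OF has_vector_derivative_Complex[OF assms]]
      complex_eq_iff algebra_simps)

section \<open>Berezin's equations on the ball\<close>

text \<open>The constructors are injective with disjoint ranges covering the type.\<close>

lemma sum_ngen:
  fixes f :: "'n::finite ngen \<Rightarrow> 'a::comm_monoid_add"
  shows "sum f UNIV = f NI + (\<Sum>i\<in>UNIV. f (Na i)) + (\<Sum>i\<in>UNIV. f (Nad i))
    + (\<Sum>i\<in>UNIV. \<Sum>j\<in>UNIV. f (NK0 i j)) + (\<Sum>i\<in>UNIV. \<Sum>j\<in>UNIV. f (NKp i j))
    + (\<Sum>i\<in>UNIV. \<Sum>j\<in>UNIV. f (NKm i j))"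
proof -
  have UN: "(UNIV :: 'n ngen set) = {NI} \<union> range Na \<union> range Nad \<union> range (case_prod NK0)
      \<union> range (case_prod NKp) \<union> range (case_prod NKm)" (is "_ = ?U")
  proof -
    have "g \<in> ?U" for g :: "'n ngen"
      by (cases g) (auto simp: image_iff)
    then show ?thesis
      by blast
  qed
  have inj: "inj Na" "inj Nad" "inj (case_prod NK0)" "inj (case_prod NKp)" "inj (case_prod NKm)"
    by (auto simp: inj_def)
  have "sum f UNIV = f NI + sum f (range Na) + sum f (range Nad) + sum f (range (case_prod NK0))
      + sum f (range (case_prod NKp)) + sum f (range (case_prod NKm))"
    unfolding UN
    by ((subst sum.union_disjoint, simp, simp, force)+, simp)
  then show ?thesis
    unfolding inj[THEN sum.reindex] sum.cartesian_product UNIV_Times_UNIV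
    by (simp add: comp_def case_prod_unfold)
qed

lemma sum_of_bool [simp]:
  fixes f :: "'n::finite \<Rightarrow> 'a::semiring_1"
  shows "(\<Sum>i\<in>UNIV. f i * of_bool (i = a)) = f a" and "(\<Sum>i\<in>UNIV. f i * of_bool (a = i)) = f a"
  by (simp_all add: of_bool_def if_distrib cong: if_cong)

lemma sum_sum_of_bool [simp]:
  fixes f :: "'n::finite \<Rightarrow> 'm::finite \<Rightarrow> 'a::comm_semiring_1"
  shows "(\<Sum>i\<in>UNIV. \<Sum>j\<in>UNIV. f i j * of_bool (i = a \<and> j = b)) = f a b"
proof -
  have "of_bool (i = a \<and> j = b) = (of_bool (j = b) * of_bool (i = a) :: 'a)" for i j
    by simp
  then show ?thesis
    by (simp only: mult.assoc[symmetric] sum_distrib_right[symmetric] sum_of_bool)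
qed

lemma Hn_nth:
  "Hn \<epsilon> \<epsilon>0 \<epsilon>p \<epsilon>m $ NI = 0" "Hn \<epsilon> \<epsilon>0 \<epsilon>p \<epsilon>m $ Na i = \<epsilon> $ i" "Hn \<epsilon> \<epsilon>0 \<epsilon>p \<epsilon>m $ Nad i = cnj (\<epsilon> $ i)"
  "Hn \<epsilon> \<epsilon>0 \<epsilon>p \<epsilon>m $ NK0 i j = \<epsilon>0 $ i $ j" "Hn \<epsilon> \<epsilon>0 \<epsilon>p \<epsilon>m $ NKp i j = \<epsilon>p $ i $ j"
  "Hn \<epsilon> \<epsilon>0 \<epsilon>p \<epsilon>m $ NKm i j = \<epsilon>m $ i $ j"
  by (simp_all add: Hn_def del: sum_mult_of_bool_eq)

section \<open>Entrywise conjugation and injectivity on the Siegel ball\<close>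

lemma vcnj_simps:
  "vcnj (vcnj x) = x" "vcnj (x + y) = vcnj x + vcnj y" "vcnj (x - y) = vcnj x - vcnj y"
  "vcnj (- x) = - vcnj x" "vcnj (c *s x) = cnj c *s vcnj x" "vcnj (A *v x) = mcnj A *v vcnj x"
  by (simp_all add: vec_eq_iff vcnj_def mcnj_def matrix_vector_mult_def)

lemma vcnj_0: "vcnj 0 = 0"
  by (simp add: vec_eq_iff vcnj_def)

lemma mcnj_mcnj: "mcnj (mcnj A) = A"
  by (simp add: vec_eq_iff mcnj_def)

lemma mcnj_transpose: "mcnj (transpose A) = transpose (mcnj A)"
  by (simp add: vec_eq_iff mcnj_def transpose_def)

lemma msmult_mult_vec: "msmult c A *v x = c *s (A *v x)"
  by (simp add: vec_eq_iff msmult_def matrix_vector_mult_def sum_distrib_left mult.assoc)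

lemma msym_mult_vec: "msym A *v x = (1/2) *s (A *v x + transpose A *v x)"
  by (simp only: msym_def msmult_mult_vec matrix_vector_mult_add_rdistrib)

lemma matrix_vector_mult_uminus:
  fixes A :: "'a::ring_1 ^ 'n ^ 'm"
  shows "A *v - x = - (A *v x)" "- A *v x = - (A *v x)"
  by (simp_all add: vec_eq_iff matrix_vector_mult_def sum_negf)

lemma positive_definite_mult_eq_0:
  assumes "positive_definite A" "A *v x = 0"
  shows "x = 0"
proof (rule ccontr)
  assume "x \<noteq> 0"
  with assms(1) have "0 < Re (\<Sum>i\<in>UNIV. cnj (x $ i) * (A *v x) $ i)"
    by (simp add: positive_definite_def)
  then show False
    by (simp add: assms(2))
qed

text \<open>The hypothesis, conjugated and substituted into itself, puts \<open>Y\<close> in the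
  kernel of a positive definite matrix.\<close>

lemma eq_0_if_add_mult_vcnj_eq_0:
  assumes W: "W \<in> siegel_ball" and Y: "Y + W *v vcnj Y = 0"
  shows "Y = 0"
proof -
  have eq: "W *v vcnj Y = - Y"
    using Y by (simp add: add_eq_0_iff)
  have "mcnj W *v Y = - vcnj Y"
    using arg_cong[OF eq, of vcnj] by (simp add: vcnj_simps)
  then have "(mat 1 - W ** mcnj W) *v Y = Y - W *v (- vcnj Y)"
    by (simp add: matrix_vector_mult_diff_rdistrib matrix_vector_mul_assoc[symmetric])
  also have "\<dots> = 0"
    using eq matrix_vector_mult_diff_distrib[of W 0 "vcnj Y"] by simp
  finally show ?thesis
    using W positive_definite_mult_eq_0 by (auto simp: siegel_ball_def)
qed

lemma symmetric_nth: "transpose A = A \<Longrightarrow> A $ i $ j = A $ j $ i"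
  by (metis transpose_def vec_lambda_beta)

text \<open>Summing over the first index of \<epsilon>0 produces its transpose; the two halves of
  the K_+ coefficient coincide by symmetry of \<epsilon>p and become W \<epsilon>p z by symmetry of
  W.\<close>

lemma ball_z_rhs:
  fixes W :: "complex ^ 'n ^ 'n"
  assumes W: "transpose W = W" and p: "transpose \<epsilon>p = \<epsilon>p"
    and z: "\<And>i. c (Bz i) = z $ i" and w: "\<And>i j. c (Bw i j) = W $ i $ j"
  shows "(\<Sum>g\<in>UNIV. Hn \<epsilon> \<epsilon>0 \<epsilon>p \<epsilon>m $ g * dQ (ball_action \<kappa> g) (Bz l) c)
    = (\<epsilon> + W *v vcnj \<epsilon> + (1/2) *s (transpose \<epsilon>0 *v z) + W *v (\<epsilon>p *v z)) $ l"
proof -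
  have "(\<Sum>g\<in>UNIV. Hn \<epsilon> \<epsilon>0 \<epsilon>p \<epsilon>m $ g * dQ (ball_action \<kappa> g) (Bz l) c)
      = (\<Sum>i\<in>UNIV. \<epsilon> $ i * of_bool (l = i)) + (\<Sum>i\<in>UNIV. cnj (\<epsilon> $ i) * W $ i $ l)
        + (\<Sum>i\<in>UNIV. \<Sum>j\<in>UNIV. \<epsilon>0 $ i $ j * z $ i / 2 * of_bool (l = j))
        + ((\<Sum>i\<in>UNIV. \<Sum>j\<in>UNIV. \<epsilon>p $ i $ j * z $ i * W $ j $ l / 2)
          + (\<Sum>i\<in>UNIV. \<Sum>j\<in>UNIV. \<epsilon>p $ i $ j * z $ j * W $ i $ l / 2))"
    by (simp add: sum_ngen Hn_nth ball_op_def z w sum.distrib[symmetric] ring_distribs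
        add_divide_distrib mult.assoc del: sum_of_bool)
  also have "(\<Sum>i\<in>UNIV. \<Sum>j\<in>UNIV. \<epsilon>p $ i $ j * z $ i * W $ j $ l / 2)
      = (\<Sum>i\<in>UNIV. \<Sum>j\<in>UNIV. \<epsilon>p $ i $ j * z $ j * W $ i $ l / 2)"
    by (subst sum.swap) (simp add: symmetric_nth[OF p, of _ i for i] cong: sum.cong)
  finally show ?thesis
    unfolding sum_of_bool
    by (simp add: vcnj_def matrix_vector_mult_def transpose_def sum_distrib_left
        symmetric_nth[OF W, of l] mult_ac sum_divide_distrib)
qed

text \<open>The two halves of the K_0 coefficient are W \<epsilon>0 and its transpose, whence
  \<open>msym\<close>; the halves for K_+ and K_- merge because \<epsilon>p and \<epsilon>m are
  symmetric.\<close>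

lemma ball_W_rhs:
  fixes W :: "complex ^ 'n ^ 'n"
  assumes W: "transpose W = W" and p: "transpose \<epsilon>p = \<epsilon>p" and m: "transpose \<epsilon>m = \<epsilon>m"
    and w: "\<And>i j. c (Bw i j) = W $ i $ j"
  shows "(\<Sum>g\<in>UNIV. Hn \<epsilon> \<epsilon>0 \<epsilon>p \<epsilon>m $ g * dQ (ball_action \<kappa> g) (Bw l k) c)
    = (\<epsilon>m + msym (W ** \<epsilon>0) + W ** \<epsilon>p ** W) $ l $ k"
proof -
  have "(\<Sum>g\<in>UNIV. Hn \<epsilon> \<epsilon>0 \<epsilon>p \<epsilon>m $ g * dQ (ball_action \<kappa> g) (Bw l k) c)
      = ((\<Sum>i\<in>UNIV. \<Sum>j\<in>UNIV. \<epsilon>0 $ i $ j * W $ i $ l / 2 * of_bool (k = j))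
          + (\<Sum>i\<in>UNIV. \<Sum>j\<in>UNIV. \<epsilon>0 $ i $ j * W $ i $ k / 2 * of_bool (l = j)))
        + ((\<Sum>i\<in>UNIV. \<Sum>j\<in>UNIV. \<epsilon>p $ i $ j * W $ i $ l * W $ j $ k / 2)
          + (\<Sum>i\<in>UNIV. \<Sum>j\<in>UNIV. \<epsilon>p $ i $ j * W $ i $ k * W $ j $ l / 2))
        + ((\<Sum>i\<in>UNIV. \<Sum>j\<in>UNIV. \<epsilon>m $ i $ j / 2 * of_bool (i = l \<and> j = k))
          + (\<Sum>i\<in>UNIV. \<Sum>j\<in>UNIV. \<epsilon>m $ i $ j / 2 * of_bool (i = k \<and> j = l)))"
    by (simp add: sum_ngen Hn_nth ball_op_def w sum.distrib[symmetric] ring_distribs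
        add_divide_distrib mult.assoc eq_commute[of l] eq_commute[of k]
        del: sum_of_bool sum_sum_of_bool sum_mult_of_bool_eq of_bool_conj)
  also have "(\<Sum>i\<in>UNIV. \<Sum>j\<in>UNIV. \<epsilon>p $ i $ j * W $ i $ k * W $ j $ l / 2)
      = (\<Sum>i\<in>UNIV. \<Sum>j\<in>UNIV. \<epsilon>p $ i $ j * W $ i $ l * W $ j $ k / 2)"
    by (subst sum.swap) (simp add: symmetric_nth[OF p, of _ i for i] mult_ac cong: sum.cong)
  also have "(\<Sum>i\<in>UNIV. \<Sum>j\<in>UNIV. \<epsilon>p $ i $ j * W $ i $ l * W $ j $ k / 2)
        + (\<Sum>i\<in>UNIV. \<Sum>j\<in>UNIV. \<epsilon>p $ i $ j * W $ i $ l * W $ j $ k / 2)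
      = (\<Sum>i\<in>UNIV. \<Sum>j\<in>UNIV. \<epsilon>p $ i $ j * W $ i $ l * W $ j $ k)"
    by (simp add: sum.distrib[symmetric] mult_ac)
  also have "\<dots> = (W ** \<epsilon>p ** W) $ l $ k"
    by (subst sum.swap)
      (simp add: matrix_matrix_mult_def sum_distrib_left symmetric_nth[OF W, of l] mult_ac)
  finally show ?thesis
    unfolding sum_of_bool sum_sum_of_bool
    by (simp add: msym_def msmult_def matrix_matrix_mult_def transpose_def sum_divide_distrib
        sum_distrib_left symmetric_nth[OF W, of l] symmetric_nth[OF W, of k] symmetric_nth[OF m, of k]
        mult_ac ring_distribs)
qed

lemma has_vector_derivative_vec_nth:
  "(f has_vector_derivative f') F \<Longrightarrow> ((\<lambda>t. f t $ i) has_vector_derivative f' $ i) F"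
  by (rule bounded_linear.has_vector_derivative[OF bounded_linear_vec_nth])

lemma has_vector_derivative_FC_nth:
  fixes W :: "real \<Rightarrow> complex ^ 'n ^ 'm"
  assumes \<eta>: "(\<eta> has_vector_derivative \<eta>') (at \<tau>)" and \<theta>: "(\<theta> has_vector_derivative \<theta>') (at \<tau>)"
    and W: "(W has_vector_derivative W') (at \<tau>)"
  shows "((\<lambda>t. (\<eta> t - W t *v vcnj (\<theta> t)) $ l) has_vector_derivative
      (\<eta>' - (W \<tau> *v vcnj \<theta>' + W' *v vcnj (\<theta> \<tau>))) $ l) (at \<tau>)"
  unfolding matrix_vector_mult_def vcnj_def vector_minus_component vector_add_component
    vec_lambda_beta sum.distrib[symmetric]
  by (intro has_vector_derivative_diff has_vector_derivative_sum has_vector_derivative_mult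
      has_vector_derivative_vec_nth assms bounded_linear.has_vector_derivative[OF bounded_linear_cnj])

lemma berezin_eqs_ball_FC_iff:
  fixes \<epsilon> :: "complex ^ 'n"
  assumes \<eta>: "\<eta> differentiable (at \<tau>)" and W: "W differentiable (at \<tau>)"
    and ball: "W \<tau> \<in> siegel_ball" and herm: "hermitian_coeffs_n \<epsilon>0 \<epsilon>p \<epsilon>m"
  shows "berezin_eqs (ball_action \<kappa>) (Hn \<epsilon> \<epsilon>0 \<epsilon>p \<epsilon>m) (ball_FC \<eta> W) \<tau> \<longleftrightarrow>
    ball_W_eq \<epsilon>0 \<epsilon>p \<epsilon>m W \<tau> \<and> ball_eta_eq \<epsilon> \<epsilon>0 \<epsilon>m \<eta> \<tau>"
proof -
  define B where "B = \<epsilon>m + msym (W \<tau> ** \<epsilon>0) + W \<tau> ** \<epsilon>p ** W \<tau>"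
  define V where "V = msmult \<i> (dot W \<tau>) - B"
  define R where "R = \<epsilon> + \<epsilon>m *v vcnj (\<eta> \<tau>) + (1/2) *s (transpose \<epsilon>0 *v \<eta> \<tau>)"
  define Y where "Y = \<i> *s dot \<eta> \<tau> - R"
  define z where "z = \<eta> \<tau> - W \<tau> *v vcnj (\<eta> \<tau>)"
  define Q where "Q = \<epsilon> + W \<tau> *v vcnj \<epsilon> + (1/2) *s (transpose \<epsilon>0 *v z) + W \<tau> *v (\<epsilon>p *v z)"
  have \<eta>': "(\<eta> has_vector_derivative dot \<eta> \<tau>) (at \<tau>)"
    and W': "(W has_vector_derivative dot W \<tau>) (at \<tau>)"
    using \<eta> W by (simp_all add: vector_derivative_works)
  have WT: "transpose (W \<tau>) = W \<tau>"
    using ball by (simp add: siegel_ball_def)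
  have p: "transpose \<epsilon>p = \<epsilon>p" and m: "transpose \<epsilon>m = \<epsilon>m"
    \<comment> \<open>The form in which hermiticity enters the conjugate of
      \<open>Y\<close>.\<close>
    and pm: "mcnj \<epsilon>m = \<epsilon>p" and h0: "mcnj (transpose \<epsilon>0) = \<epsilon>0"
    using herm by (auto simp: hermitian_coeffs_n_def mcnj_transpose mcnj_mcnj)
  let ?dz = "dot \<eta> \<tau> - (W \<tau> *v vcnj (dot \<eta> \<tau>) + dot W \<tau> *v vcnj (\<eta> \<tau>))"
  have dz: "dot (\<lambda>t. ball_FC \<eta> W t (Bz l)) \<tau> = ?dz $ l" for l
    unfolding ball_FC_def ball_coord.case
    by (rule vector_derivative_at has_vector_derivative_FC_nth \<eta>' W')+
  have dw: "dot (\<lambda>t. ball_FC \<eta> W t (Bw l k)) \<tau> = dot W \<tau> $ l $ k" for l k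
    unfolding ball_FC_def ball_coord.case
    by (intro vector_derivative_at has_vector_derivative_vec_nth W')
  have all_coord: "(\<forall>\<beta>. P \<beta>) \<longleftrightarrow> (\<forall>l. P (Bz l)) \<and> (\<forall>l k. P (Bw l k))"
    for P :: "'n ball_coord \<Rightarrow> bool"
    by (metis ball_coord.exhaust)
  have Q: "(\<Sum>g\<in>UNIV. Hn \<epsilon> \<epsilon>0 \<epsilon>p \<epsilon>m $ g * dQ (ball_action \<kappa> g) (Bz l) (ball_FC \<eta> W \<tau>)) = Q $ l" for l
    unfolding Q_def by (rule ball_z_rhs[OF WT p]) (simp_all add: ball_FC_def z_def)
  have B: "(\<Sum>g\<in>UNIV. Hn \<epsilon> \<epsilon>0 \<epsilon>p \<epsilon>m $ g * dQ (ball_action \<kappa> g) (Bw l k) (ball_FC \<eta> W \<tau>)) = B $ l $ k" for l k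
    unfolding B_def by (rule ball_W_rhs[OF WT p m]) (simp add: ball_FC_def)
  have "berezin_eqs (ball_action \<kappa>) (Hn \<epsilon> \<epsilon>0 \<epsilon>p \<epsilon>m) (ball_FC \<eta> W) \<tau> \<longleftrightarrow>
      \<i> *s ?dz = Q \<and> msmult \<i> (dot W \<tau>) = B"
    unfolding berezin_eqs_def all_coord dz dw Q B by (simp add: vec_eq_iff msmult_def ring_distribs)
  also have "\<dots> \<longleftrightarrow> \<i> *s ?dz - Q = 0 \<and> V = 0"
    by (simp add: V_def)
  also have "\<i> *s ?dz - Q = Y + W \<tau> *v vcnj Y - V *v vcnj (\<eta> \<tau>)"
  proof -
    have V: "V *v x = \<i> *s (dot W \<tau> *v x) - (\<epsilon>m *v x + (1/2) *s (W \<tau> *v (\<epsilon>0 *v x)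
        + transpose \<epsilon>0 *v (W \<tau> *v x)) + W \<tau> *v (\<epsilon>p *v (W \<tau> *v x)))" for x
      unfolding V_def B_def matrix_vector_mult_diff_rdistrib matrix_vector_mult_add_rdistrib
        msmult_mult_vec msym_mult_vec matrix_transpose_mul WT matrix_vector_mul_assoc[symmetric] ..
    have "vcnj Y = (- \<i>) *s vcnj (dot \<eta> \<tau>)
        - (vcnj \<epsilon> + \<epsilon>p *v \<eta> \<tau> + (1/2) *s (\<epsilon>0 *v vcnj (\<eta> \<tau>)))"
      unfolding Y_def R_def vcnj_simps pm h0 by simp
    then have Y: "W \<tau> *v vcnj Y = (- \<i>) *s (W \<tau> *v vcnj (dot \<eta> \<tau>))
        - (W \<tau> *v vcnj \<epsilon> + W \<tau> *v (\<epsilon>p *v \<eta> \<tau>) + (1/2) *s (W \<tau> *v (\<epsilon>0 *v vcnj (\<eta> \<tau>))))"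
      by (simp only: matrix_vector_right_distrib matrix_vector_mult_diff_distrib vector_scalar_commute)
    \<comment> \<open>Each iterated matrix-vector product becomes one scalar variable. Here
      \<open>f\<close> stands for \<epsilon>m applied to the conjugate of \<eta> and
      \<open>g\<close> for W \<epsilon>0 applied to it; both occur on the right only and cancel
      there.\<close>
    have id: "c * (a1 - (a2 + a3)) - (e + e' + h * (b1 - b2) + (d1 - d2))
        = c * a1 - (e + f + h * b1) + (- c * a2 - (e' + d1 + h * g))
          - (c * a3 - (f + h * (g + b2) + d2))"
      for a1 a2 a3 b1 b2 c d1 d2 e e' f g h :: complex
      by (simp add: algebra_simps)
    show ?thesis
      unfolding V Y unfolding Q_def Y_def R_def z_def
        matrix_vector_right_distrib matrix_vector_mult_diff_distrib
      unfolding vec_eq_iff vector_minus_component vector_add_component vector_smult_component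
      by (intro allI, rule id)
  qed
  also have "Y + W \<tau> *v vcnj Y - V *v vcnj (\<eta> \<tau>) = 0 \<and> V = 0 \<longleftrightarrow> V = 0 \<and> Y = 0"
    using eq_0_if_add_mult_vcnj_eq_0[OF ball, of Y] by (auto simp: vcnj_0)
  finally show ?thesis
    by (simp add: V_def Y_def B_def R_def ball_W_eq_def ball_eta_eq_def)
qed

section \<open>The real form\<close>

lemma sum_sum_type: "sum f (UNIV :: ('a::finite + 'b::finite) set) = (\<Sum>i\<in>UNIV. f (Inl i)) + (\<Sum>i\<in>UNIV. f (Inr i))"
  unfolding UNIV_Plus_UNIV[symmetric] by (simp add: sum.Plus comp_def del: UNIV_Plus_UNIV)

lemma all_sum_type: "(\<forall>s. P s) \<longleftrightarrow> (\<forall>i. P (Inl i)) \<and> (\<forall>i. P (Inr i))"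
  by (metis sumE)

lemma mblock_mult_vblock: "mblock A B C D *v vblock u v = vblock (A *v u + B *v v) (C *v u + D *v v)"
  by (simp add: vec_eq_iff all_sum_type mblock_def vblock_def matrix_vector_mult_def sum_sum_type)

lemma vblock_eq_iff: "vblock u v = vblock u' v' \<longleftrightarrow> u = u' \<and> v = v'"
  by (simp add: vec_eq_iff all_sum_type vblock_def)

lemma vblock_add: "vblock u v + vblock u' v' = vblock (u + u') (v + v')"
  by (simp add: vec_eq_iff all_sum_type vblock_def)

lemma mblock_mult_mblock:
  "mblock A B C D ** mblock A' B' C' D'
    = mblock (A ** A' + B ** C') (A ** B' + B ** D') (C ** A' + D ** C') (C ** B' + D ** D')"
  by (simp add: vec_eq_iff all_sum_type mblock_def matrix_matrix_mult_def sum_sum_type)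

lemma mblock_add:
  "mblock A B C D + mblock A' B' C' D' = mblock (A + A') (B + B') (C + C') (D + D')"
  by (simp add: vec_eq_iff all_sum_type mblock_def)

lemma mblock_zero: "mblock 0 0 0 0 = 0"
  by (simp add: vec_eq_iff all_sum_type mblock_def)

lemma transpose_mblock:
  "transpose (mblock A B C D) = mblock (transpose A) (transpose C) (transpose B) (transpose D)"
  by (simp add: vec_eq_iff all_sum_type mblock_def transpose_def)

lemma transpose_arith:
  "transpose (A + B) = transpose A + transpose B" "transpose (A - B) = transpose A - transpose B"
  "transpose (- A) = - transpose (A :: 'a::ab_group_add ^ 'n ^ 'm)"
  by (simp_all add: vec_eq_iff transpose_def)

lemma matrix_minus_one: "A ** - mat 1 = - (A :: real ^ 'n ^ 'n)" "- mat 1 ** A = - A"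
  by (simp_all add: vec_eq_iff matrix_matrix_mult_def mat_def if_distrib if_distribR sum_negf cong: if_cong)

text \<open>In block form the condition says that the off-diagonal blocks are symmetric and that the
  lower right block is minus the transpose of the upper left; indeed -n + q is minus the transpose
  of n + q.\<close>

lemma h_r_in_sp_algebra:
  assumes "transpose m = m" "transpose n = n" "transpose p = p" "transpose q = - q"
  shows "h_r m n p q \<in> sp_algebra"
  by (simp add: sp_algebra_def h_r_def Let_def transpose_mblock transpose_arith assms
      mblock_mult_mblock mblock_add matrix_minus_one mblock_zero)

text \<open>\<open>cvec\<close> is the sum of two real-linear maps of one variable each, and linear
  maps preserve derivatives.\<close>

lemma has_vector_derivative_cvec:
  assumes "(u has_vector_derivative u') (at \<tau>)" "(v has_vector_derivative v') (at \<tau>)"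
  shows "((\<lambda>t. cvec (u t) (v t)) has_vector_derivative cvec u' (v' :: real ^ 'n)) (at \<tau>)"
proof -
  have "bounded_linear (\<lambda>u :: real ^ 'n. cvec u 0)" "bounded_linear (\<lambda>v :: real ^ 'n. cvec 0 v)"
    unfolding linear_conv_bounded_linear[symmetric]
    by (intro linearI; simp add: vec_eq_iff cvec_def complex_eq_iff)+
  then have "((\<lambda>t. cvec (u t) 0 + cvec 0 (v t)) has_vector_derivative cvec u' 0 + cvec 0 v') (at \<tau>)"
    by (intro has_vector_derivative_add) (auto intro: bounded_linear.has_vector_derivative assms)
  moreover have "cvec x 0 + cvec 0 y = cvec x y" for x y :: "real ^ 'n"
    by (simp add: vec_eq_iff cvec_def complex_eq_iff)
  ultimately show ?thesis
    by simp
qed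

lemma has_vector_derivative_vblock:
  assumes "(u has_vector_derivative u') (at \<tau>)" "(v has_vector_derivative v') (at \<tau>)"
  shows "((\<lambda>t. vblock (u t) (v t)) has_vector_derivative vblock u' (v' :: real ^ 'n)) (at \<tau>)"
proof -
  have "bounded_linear (\<lambda>u :: real ^ 'n. vblock u 0)" "bounded_linear (\<lambda>v :: real ^ 'n. vblock 0 v)"
    unfolding linear_conv_bounded_linear[symmetric]
    by (intro linearI; simp add: vec_eq_iff all_sum_type vblock_def)+
  then have "((\<lambda>t. vblock (u t) 0 + vblock 0 (v t)) has_vector_derivative vblock u' 0 + vblock 0 v') (at \<tau>)"
    by (intro has_vector_derivative_add) (auto intro: bounded_linear.has_vector_derivative assms)
  then show ?thesis
    by (simp add: vblock_add)
qed

lemma cvec_eq_iff: "cvec u v = cvec u' v' \<longleftrightarrow> u = u' \<and> v = v'"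
  by (auto simp: vec_eq_iff cvec_def)

lemma cmat_mult_cvec: "cmat A B *v cvec u v = cvec (A *v u - B *v v) (A *v v + B *v u)"
  by (simp add: vec_eq_iff cmat_def cvec_def matrix_vector_mult_def complex_eq_iff
      Re_sum Im_sum sum_subtractf sum.distrib)

text \<open>With \<eta> = \<xi> - i \<zeta> the left side is \<zeta>' + i \<xi>', so real parts give
  the lower block row and imaginary parts the upper one; hence F = (a, b) for \<epsilon> = b +
  ia.\<close>

lemma ball_eta_eq_real:
  fixes \<epsilon>0 :: "complex ^ 'n ^ 'n"
  assumes "msmult (1/2) (transpose \<epsilon>0) = cmat p q"
    and "\<xi> differentiable (at \<tau>)" "\<zeta> differentiable (at \<tau>)"
  shows "ball_eta_eq (cvec b a) \<epsilon>0 (cmat m n) (\<lambda>t. cvec (\<xi> t) (- \<zeta> t)) \<tau>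
    \<longleftrightarrow> ball_real_eq a b m n p q \<xi> \<zeta> \<tau>"
proof -
  have \<xi>: "(\<xi> has_vector_derivative dot \<xi> \<tau>) (at \<tau>)" and \<zeta>: "(\<zeta> has_vector_derivative dot \<zeta> \<tau>) (at \<tau>)"
    using assms(2,3) by (simp_all add: vector_derivative_works)
  have d: "dot (\<lambda>t. cvec (\<xi> t) (- \<zeta> t)) \<tau> = cvec (dot \<xi> \<tau>) (- dot \<zeta> \<tau>)"
      "dot (\<lambda>t. vblock (\<xi> t) (\<zeta> t)) \<tau> = vblock (dot \<xi> \<tau>) (dot \<zeta> \<tau>)"
    by (intro vector_derivative_at has_vector_derivative_cvec has_vector_derivative_vblock
        has_vector_derivative_minus \<xi> \<zeta>)+
  have arith: "\<i> *s cvec u (- v) = cvec v u" "vcnj (cvec u v) = cvec u (- v)"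
      "cvec u v + cvec u' v' = cvec (u + u') (v + v')" for u v u' v' :: "real ^ 'n"
    by (simp_all add: vec_eq_iff cvec_def vcnj_def complex_eq_iff)
  have half: "(1/2) *s (transpose \<epsilon>0 *v x) = cmat p q *v x" for x
    by (simp only: msmult_mult_vec[symmetric] assms(1))
  show ?thesis
    unfolding ball_eta_eq_def ball_real_eq_def d h_r_def half mblock_mult_vblock vblock_add
      vblock_eq_iff arith cmat_mult_cvec cvec_eq_iff
    by (auto simp: matrix_vector_mult_add_rdistrib matrix_vector_mult_diff_rdistrib matrix_vector_mult_uminus algebra_simps)
qed

lemma cmat_eq_iff: "cmat A B = cmat A' B' \<longleftrightarrow> A = A' \<and> B = B'"
  by (auto simp: vec_eq_iff cmat_def)

lemma transpose_cmat: "transpose (cmat A B) = cmat (transpose A) (transpose B)"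
  by (simp add: vec_eq_iff cmat_def transpose_def)

lemma mcnj_cmat: "mcnj (cmat A B) = cmat A (- B)"
  by (simp add: vec_eq_iff cmat_def mcnj_def complex_eq_iff)

lemma hermitian_coeffs_n_real:
  assumes herm: "hermitian_coeffs_n \<epsilon>0 \<epsilon>p (cmat m n)"
    and pq: "msmult (1/2) (transpose \<epsilon>0) = cmat p q"
  shows "transpose m = m" "transpose n = n" "transpose p = p" "transpose q = - q"
proof -
  have "transpose (cmat m n) = cmat m n"
    using herm by (simp add: hermitian_coeffs_n_def)
  then show "transpose m = m" "transpose n = n"
    by (simp_all add: transpose_cmat cmat_eq_iff)
  have h0: "mcnj \<epsilon>0 = transpose \<epsilon>0"
    using herm by (metis hermitian_coeffs_n_def transpose_transpose)
  \<comment> \<open>Half the transpose of \<epsilon>0 is again Hermitian, so its real part is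
    symmetric and its imaginary part antisymmetric.\<close>
  have "transpose (mcnj (msmult (1/2) (transpose \<epsilon>0))) = msmult (1/2) (mcnj \<epsilon>0)"
    by (simp add: vec_eq_iff transpose_def mcnj_def msmult_def)
  then have "cmat (transpose p) (- transpose q) = cmat p q"
    by (simp add: h0 pq mcnj_cmat transpose_cmat transpose_arith)
  then show "transpose p = p" "transpose q = - q"
    unfolding cmat_eq_iff by (metis minus_minus)+
qed

section \<open>Dimension one\<close>

text \<open>Over a one-element index type every entry is diagonal, so \<open>mat\<close> identifies
  scalars with 1 x 1 matrices.\<close>

lemma mat_one_nth [simp]: "(mat c :: 'a::zero ^ 1 ^ 1) $ i $ j = c"
  by (simp add: mat_def num1_eq_iff)

lemma msmult_mat_one: "msmult c (mat x :: complex ^ 1 ^ 1) = mat (c * x)"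
  by (simp add: vec_eq_iff msmult_def)

lemma transpose_mat_one: "transpose (mat x :: 'a::zero ^ 1 ^ 1) = mat x"
  by (simp add: vec_eq_iff transpose_def)

lemma mcnj_mat_one: "mcnj (mat x :: complex ^ 1 ^ 1) = mat (cnj x)"
  by (simp add: vec_eq_iff mcnj_def)

lemma mat_one_mult: "(mat x :: 'a::semiring_1 ^ 1 ^ 1) ** mat y = mat (x * y)"
  by (simp add: vec_eq_iff matrix_matrix_mult_def sum_1)

lemma mat_one_mult_vec: "(mat x :: 'a::semiring_1 ^ 1 ^ 1) *v vec y = vec (x * y)"
  by (simp add: vec_eq_iff matrix_vector_mult_def sum_1)

lemma mat_one_arith:
  "(mat x :: 'a::ring ^ 1 ^ 1) + mat y = mat (x + y)" "(mat x :: 'a ^ 1 ^ 1) - mat y = mat (x - y)"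
  "- (mat x :: 'a ^ 1 ^ 1) = mat (- x)"
  by (simp_all add: vec_eq_iff)

lemma mat_one_eq_iff: "(mat x :: 'a::zero ^ 1 ^ 1) = mat y \<longleftrightarrow> x = y"
  by (simp add: vec_eq_iff)

lemma mat_mem_siegel_ball_iff: "(mat w :: complex ^ 1 ^ 1) \<in> siegel_ball \<longleftrightarrow> w \<in> siegel_disk"
proof -
  have c: "1 - w * cnj w = complex_of_real (1 - (cmod w)\<^sup>2)"
    by (simp add: complex_norm_square[symmetric])
  have quad: "cnj z * ((1 - w * cnj w) * z) = complex_of_real ((1 - (cmod w)\<^sup>2) * (cmod z)\<^sup>2)" for z
    unfolding c of_real_mult complex_norm_square by (simp add: mult_ac)
  have D: "mat 1 - mat w ** mcnj (mat w) = (mat (1 - w * cnj w) :: complex ^ 1 ^ 1)"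
    by (simp add: mcnj_mat_one mat_one_mult mat_one_arith)
  have sum: "(\<Sum>i\<in>UNIV. cnj (v $ i) * (mat (1 - w * cnj w) *v v) $ i)
      = complex_of_real ((1 - (cmod w)\<^sup>2) * (cmod (v $ 1))\<^sup>2)" for v :: "complex ^ 1"
    unfolding quad[symmetric] by (simp add: matrix_vector_mult_def sum_1)
  have "(mat w :: complex ^ 1 ^ 1) \<in> siegel_ball \<longleftrightarrow>
      (\<forall>v :: complex ^ 1. v \<noteq> 0 \<longrightarrow> 0 < (1 - (cmod w)\<^sup>2) * (cmod (v $ 1))\<^sup>2)"
    unfolding siegel_ball_def mem_Collect_eq positive_definite_def D sum Re_complex_of_real
    by (simp add: transpose_mat_one mcnj_mat_one mat_one_eq_iff mult.commute)
  also have "\<dots> \<longleftrightarrow> 0 < 1 - (cmod w)\<^sup>2"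
  proof
    assume "\<forall>v :: complex ^ 1. v \<noteq> 0 \<longrightarrow> 0 < (1 - (cmod w)\<^sup>2) * (cmod (v $ 1))\<^sup>2"
    then show "0 < 1 - (cmod w)\<^sup>2"
      \<comment> \<open>The constant vector 1 tests positivity.\<close>
      by (auto dest!: spec[of _ "vec 1"] simp: vec_eq_iff)
  qed (auto simp: vec_eq_iff)
  also have "\<dots> \<longleftrightarrow> w \<in> siegel_disk"
    by (simp add: siegel_disk_def abs_square_less_1)
  finally show ?thesis .
qed

lemma has_vector_derivative_vec:
  assumes "(f has_vector_derivative f') (at \<tau>)"
  shows "((\<lambda>t. vec (f t) :: 'a::euclidean_space ^ 1) has_vector_derivative vec f') (at \<tau>)"
proof -
  have "bounded_linear (vec :: 'a \<Rightarrow> 'a ^ 1)"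
    unfolding linear_conv_bounded_linear[symmetric] by (intro linearI) (simp_all add: vec_eq_iff)
  from bounded_linear.has_vector_derivative[OF this assms] show ?thesis .
qed

lemma has_vector_derivative_mat:
  assumes "(f has_vector_derivative f') (at \<tau>)"
  shows "((\<lambda>t. mat (f t) :: complex ^ 1 ^ 1) has_vector_derivative mat f') (at \<tau>)"
proof -
  have "bounded_linear (mat :: complex \<Rightarrow> complex ^ 1 ^ 1)"
    unfolding linear_conv_bounded_linear[symmetric] by (intro linearI) (simp_all add: vec_eq_iff)
  from bounded_linear.has_vector_derivative[OF this assms] show ?thesis .
qed

text \<open>\<epsilon>m and \<epsilon>p trade places here: this is the exchange of notation between
  the two kinds of equations.\<close>

lemma hermitian_coeffs_n_mat:
  assumes "hermitian_coeffs \<epsilon>0 \<epsilon>p \<epsilon>m"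
  shows "hermitian_coeffs_n (mat \<epsilon>0 :: complex ^ 1 ^ 1) (mat \<epsilon>m) (mat \<epsilon>p)"
  using assms by (auto simp: hermitian_coeffs_def hermitian_coeffs_n_def transpose_mat_one mcnj_mat_one)

lemma Hn_one_nth:
  "Hn (vec \<epsilon>a) (mat \<epsilon>0) (mat \<epsilon>p) (mat \<epsilon>m) $ g = H0 \<epsilon>a \<epsilon>0 \<epsilon>p \<epsilon>m $ ngen_one g"
  by (cases g) (simp_all add: Hn_nth H0_nth)

lemma wn_w_eq_iff_ball_W_eq:
  assumes "w differentiable (at \<tau>)"
  shows "wn_w_eq \<epsilon>0 \<epsilon>p \<epsilon>m w \<tau> \<longleftrightarrow>
    ball_W_eq (mat \<epsilon>0 :: complex ^ 1 ^ 1) (mat \<epsilon>m) (mat \<epsilon>p) (\<lambda>t. mat (w t)) \<tau>"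
proof -
  have "dot (\<lambda>t. mat (w t) :: complex ^ 1 ^ 1) \<tau> = mat (dot w \<tau>)"
    using assms by (intro vector_derivative_at has_vector_derivative_mat) (simp add: vector_derivative_works)
  then show ?thesis
    by (simp add: wn_w_eq_def ball_W_eq_def msym_def msmult_mat_one transpose_mat_one mat_one_mult
        mat_one_arith mat_one_eq_iff power2_eq_square mult_ac)
qed

lemma wn_eta_eq_iff_ball_eta_eq:
  assumes "\<eta> differentiable (at \<tau>)"
  shows "wn_eta_eq \<epsilon>a \<epsilon>0 \<epsilon>p \<eta> \<tau> \<longleftrightarrow>
    ball_eta_eq (vec (cnj \<epsilon>a) :: complex ^ 1) (mat \<epsilon>0) (mat \<epsilon>p) (\<lambda>t. vec (\<eta> t)) \<tau>"
proof -
  have d: "dot (\<lambda>t. vec (\<eta> t) :: complex ^ 1) \<tau> = vec (dot \<eta> \<tau>)"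
    using assms by (intro vector_derivative_at has_vector_derivative_vec) (simp add: vector_derivative_works)
  have v: "vcnj (vec (\<eta> \<tau>) :: complex ^ 1) = vec (cnj (\<eta> \<tau>))"
    by (simp add: vec_eq_iff vcnj_def)
  show ?thesis
    unfolding wn_eta_eq_def ball_eta_eq_def d v transpose_mat_one mat_one_mult_vec
    by (simp add: vec_eq_iff)
qed

text \<open>The dictionary: x + iy = \<xi> - i \<zeta> gives \<zeta> = -y; b + ia = cnj \<epsilon>a
  gives b = \<nu>1, a = -\<nu>2; m + in = \<epsilon>p gives m = e1, n = -e2; and p + iq =
  \<epsilon>0 / 2 gives p = e0, q = 0.\<close>

lemma wn_xy_eq_iff_ball_real_eq:
  assumes "x differentiable (at \<tau>)" "y differentiable (at \<tau>)"
  shows "wn_xy_eq e0 e1 e2 \<nu>1 \<nu>2 x y \<tau> \<longleftrightarrow>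
    ball_real_eq (vec (- \<nu>2) :: real ^ 1) (vec \<nu>1) (mat e1) (mat (- e2)) (mat e0) 0
      (\<lambda>t. vec (x t)) (\<lambda>t. vec (- y t)) \<tau>"
proof -
  have xy: "(x has_vector_derivative dot x \<tau>) (at \<tau>)" "(y has_vector_derivative dot y \<tau>) (at \<tau>)"
    using assms by (simp_all add: vector_derivative_works)
  have d: "dot (\<lambda>t. vblock (vec (x t) :: real ^ 1) (vec (- y t))) \<tau>
      = vblock (vec (dot x \<tau>)) (vec (- dot y \<tau>))"
    by (intro vector_derivative_at has_vector_derivative_vblock has_vector_derivative_vec
        has_vector_derivative_minus xy)
  show ?thesis
    unfolding wn_xy_eq_def ball_real_eq_def d h_r_def add_0_right mat_one_arith mblock_mult_vblock
      mat_one_mult_vec vblock_add vblock_eq_iff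
    by (auto simp: vec_eq_iff algebra_simps)
qed

theorem proposition2:
  fixes J :: "real set" and k \<kappa> :: real
  assumes J: "open J" "is_interval J"
    and k: "k > 0" "2 * k \<in> \<nat>" "2 * k \<ge> 2"
  shows
    \<comment> \<open>(1) Wei-Norman and Berezin equations agree, up to the exchange of notation\<close>
    "(\<forall>\<epsilon>a \<epsilon>0 \<epsilon>p \<epsilon>m \<eta> w \<phi>.
        hermitian_coeffs \<epsilon>0 \<epsilon>p \<epsilon>m \<and> disk_curve J \<eta> w \<and> (\<forall>\<tau>\<in>J. \<phi> differentiable (at \<tau>)) \<longrightarrow>
        (\<forall>\<tau>\<in>J.
          (berezin_eqs (disk_action k) (H0 \<epsilon>a \<epsilon>0 \<epsilon>p \<epsilon>m) (disk_FC \<eta> w) \<tau> \<longleftrightarrow>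
             \<i> * dot \<eta> \<tau> = \<epsilon>a + \<epsilon>m * cnj (\<eta> \<tau>) + \<epsilon>0 / 2 * \<eta> \<tau> \<and>
             \<i> * dot w \<tau> = \<epsilon>m + \<epsilon>0 * w \<tau> + \<epsilon>p * (w \<tau>)\<^sup>2) \<and>
          (wei_norman_eqs (H0 \<epsilon>a \<epsilon>0 \<epsilon>p \<epsilon>m) \<phi> \<eta> w \<tau> \<longleftrightarrow>
             berezin_eqs (disk_action k) (H0 (cnj \<epsilon>a) \<epsilon>0 \<epsilon>m \<epsilon>p) (disk_FC \<eta> w) \<tau>))) \<and>
    \<comment> \<open>(2) the Wei-Norman equations on the disk, on the plane, and in real form\<close>
     (\<forall>\<epsilon>a \<epsilon>0 \<epsilon>p \<epsilon>m \<eta> w \<phi>.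
        hermitian_coeffs \<epsilon>0 \<epsilon>p \<epsilon>m \<and> disk_curve J \<eta> w \<and> (\<forall>\<tau>\<in>J. \<phi> differentiable (at \<tau>)) \<longrightarrow>
        (\<forall>\<tau>\<in>J. wei_norman_eqs (H0 \<epsilon>a \<epsilon>0 \<epsilon>p \<epsilon>m) \<phi> \<eta> w \<tau> \<longleftrightarrow>
             wn_w_eq \<epsilon>0 \<epsilon>p \<epsilon>m w \<tau> \<and> wn_eta_eq \<epsilon>a \<epsilon>0 \<epsilon>p \<eta> \<tau>)) \<and>
     (\<forall>e0 e1 e2 \<nu>1 \<nu>2 \<epsilon>a \<epsilon>0 \<epsilon>p \<epsilon>m.
        \<epsilon>a = Complex \<nu>1 \<nu>2 \<and> \<epsilon>0 = of_real (2 * e0) \<and> \<epsilon>p = Complex e1 (- e2) \<and> \<epsilon>m = cnj \<epsilon>p \<longrightarrow>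
        H0 \<epsilon>a \<epsilon>0 \<epsilon>p \<epsilon>m = H0_real e0 e1 e2 \<nu>1 \<nu>2 \<and>
        (\<forall>x y. \<forall>\<tau>\<in>J. x differentiable (at \<tau>) \<and> y differentiable (at \<tau>) \<longrightarrow>
           (wn_eta_eq \<epsilon>a \<epsilon>0 \<epsilon>p (\<lambda>t. Complex (x t) (y t)) \<tau> \<longleftrightarrow>
              wn_xy_eq e0 e1 e2 \<nu>1 \<nu>2 x y \<tau>))) \<and>
    \<comment> \<open>the Berezin equations on the Siegel-Jacobi ball, for every dimension\<close>
     (\<forall>(\<epsilon> :: complex ^ 'n) \<epsilon>0 \<epsilon>p \<epsilon>m \<eta> W.
        hermitian_coeffs_n \<epsilon>0 \<epsilon>p \<epsilon>m \<and> ball_curve J \<eta> W \<longrightarrow>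
        (\<forall>\<tau>\<in>J. berezin_eqs (ball_action \<kappa>) (Hn \<epsilon> \<epsilon>0 \<epsilon>p \<epsilon>m) (ball_FC \<eta> W) \<tau> \<longleftrightarrow>
             ball_W_eq \<epsilon>0 \<epsilon>p \<epsilon>m W \<tau> \<and> ball_eta_eq \<epsilon> \<epsilon>0 \<epsilon>m \<eta> \<tau>)) \<and>
     (\<forall>(\<epsilon> :: complex ^ 'n) \<epsilon>0 \<epsilon>p \<epsilon>m a b m n p q.
        hermitian_coeffs_n \<epsilon>0 \<epsilon>p \<epsilon>m \<and>
        \<epsilon> = cvec b a \<and> \<epsilon>m = cmat m n \<and> msmult (1/2) (transpose \<epsilon>0) = cmat p q \<longrightarrow>
        transpose m = m \<and> transpose n = n \<and> transpose p = p \<and> transpose q = - q \<and>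
        h_r m n p q \<in> sp_algebra \<and>
        (\<forall>\<xi> \<zeta>. \<forall>\<tau>\<in>J. \<xi> differentiable (at \<tau>) \<and> \<zeta> differentiable (at \<tau>) \<longrightarrow>
           (ball_eta_eq \<epsilon> \<epsilon>0 \<epsilon>m (\<lambda>t. cvec (\<xi> t) (- \<zeta> t)) \<tau> \<longleftrightarrow>
              ball_real_eq a b m n p q \<xi> \<zeta> \<tau>))) \<and>
    \<comment> \<open>the Wei-Norman equations are the case \<open>n = 1\<close> of the latter, after the exchange of notation\<close>
     (\<forall>\<epsilon>a \<epsilon>0 \<epsilon>p \<epsilon>m.
        hermitian_coeffs \<epsilon>0 \<epsilon>p \<epsilon>m \<longrightarrow>
        hermitian_coeffs_n (mat \<epsilon>0 :: complex ^ 1 ^ 1) (mat \<epsilon>m) (mat \<epsilon>p) \<and>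
        (\<forall>g. Hn (vec (cnj \<epsilon>a)) (mat \<epsilon>0) (mat \<epsilon>m) (mat \<epsilon>p) $ g
              = H0 (cnj \<epsilon>a) \<epsilon>0 \<epsilon>m \<epsilon>p $ ngen_one g) \<and>
        (\<forall>w. mat w \<in> (siegel_ball :: (complex ^ 1 ^ 1) set) \<longleftrightarrow> w \<in> siegel_disk) \<and>
        (\<forall>\<eta> w. disk_curve J \<eta> w \<longrightarrow>
           (\<forall>\<tau>\<in>J.
             (wn_w_eq \<epsilon>0 \<epsilon>p \<epsilon>m w \<tau> \<longleftrightarrow>
                ball_W_eq (mat \<epsilon>0 :: complex ^ 1 ^ 1) (mat \<epsilon>m) (mat \<epsilon>p) (\<lambda>t. mat (w t)) \<tau>) \<and>
             (wn_eta_eq \<epsilon>a \<epsilon>0 \<epsilon>p \<eta> \<tau> \<longleftrightarrow>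
                ball_eta_eq (vec (cnj \<epsilon>a) :: complex ^ 1) (mat \<epsilon>0) (mat \<epsilon>p) (\<lambda>t. vec (\<eta> t)) \<tau>)))) \<and>
     (\<forall>e0 e1 e2 \<nu>1 \<nu>2 \<epsilon>a \<epsilon>0 \<epsilon>p.
        \<epsilon>a = Complex \<nu>1 \<nu>2 \<and> \<epsilon>0 = of_real (2 * e0) \<and> \<epsilon>p = Complex e1 (- e2) \<longrightarrow>
        (vec (cnj \<epsilon>a) :: complex ^ 1) = cvec (vec \<nu>1) (vec (- \<nu>2)) \<and>
        (mat \<epsilon>p :: complex ^ 1 ^ 1) = cmat (mat e1) (mat (- e2)) \<and>
        msmult (1/2) (transpose (mat \<epsilon>0 :: complex ^ 1 ^ 1)) = cmat (mat e0) 0 \<and>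
        (\<forall>x y. \<forall>\<tau>\<in>J. x differentiable (at \<tau>) \<and> y differentiable (at \<tau>) \<longrightarrow>
           (wn_xy_eq e0 e1 e2 \<nu>1 \<nu>2 x y \<tau> \<longleftrightarrow>
              ball_real_eq (vec (- \<nu>2) :: real ^ 1) (vec \<nu>1) (mat e1) (mat (- e2)) (mat e0) 0
                (\<lambda>t. vec (x t)) (\<lambda>t. vec (- y t)) \<tau>)))"
  unfolding disk_curve_def ball_curve_def siegel_disk_def mem_Collect_eq
\<comment> \<open>Cases 1 and 2 are part (1), 3 to 5 the Wei-Norman equations, 6 to 12 the ball, 13
  to 21 the specialization to n = 1.\<close>
proof (intro conjI allI impI ballI, goal_cases)
  case 1 then show ?case by (intro berezin_eqs_disk_FC_iff) auto
next
  case (2 \<epsilon>a \<epsilon>0 \<epsilon>p \<epsilon>m \<eta> w \<phi> \<tau>)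
  \<comment> \<open>Hermiticity survives the exchange, so the Berezin lemma applies to the exchanged
    coefficients and yields the Wei-Norman equations.\<close>
  then have "hermitian_coeffs \<epsilon>0 \<epsilon>m \<epsilon>p"
    by (auto simp: hermitian_coeffs_def)
  with 2 show ?case
    using wei_norman_eqs_iff[of \<eta> \<tau> w \<epsilon>0 \<epsilon>p \<epsilon>m] berezin_eqs_disk_FC_iff[of \<eta> \<tau> w \<epsilon>0 \<epsilon>m \<epsilon>p k "cnj \<epsilon>a"]
    by (auto simp: wn_w_eq_def wn_eta_eq_def)
next
  case 3 then show ?case by (intro wei_norman_eqs_iff) auto
next
  case 4 then show ?case by (simp only: H0_eq_H0_real)
next
  case 5 then show ?case by (simp only: wn_eta_eq_real)
next
  case 6 then show ?case by (intro berezin_eqs_ball_FC_iff) auto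
next
  case 7 then show ?case by (metis hermitian_coeffs_n_real(1))
next
  case 8 then show ?case by (metis hermitian_coeffs_n_real(2))
next
  case 9 then show ?case by (metis hermitian_coeffs_n_real(3))
next
  case 10 then show ?case by (metis hermitian_coeffs_n_real(4))
next
  case 11 then show ?case by (metis h_r_in_sp_algebra hermitian_coeffs_n_real)
next
  case 12 then show ?case by (simp only: ball_eta_eq_real)
next
  case 13 then show ?case by (rule hermitian_coeffs_n_mat)
next
  case 14 show ?case by (rule Hn_one_nth)
next
  case 15 show ?case by (simp add: mat_mem_siegel_ball_iff siegel_disk_def)
next
  case 16 then show ?case by (intro wn_w_eq_iff_ball_W_eq) auto
next
  case 17 then show ?case by (intro wn_eta_eq_iff_ball_eta_eq) auto
next
  case 18 then show ?case by (simp add: vec_eq_iff cvec_def complex_eq_iff)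
next
  case 19 then show ?case by (simp add: vec_eq_iff cmat_def)
next
  case 20 then show ?case by (simp add: vec_eq_iff cmat_def transpose_mat_one msmult_mat_one complex_eq_iff)
next
  case 21 then show ?case by (intro wn_xy_eq_iff_ball_real_eq) auto
qed

end
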